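(* Let $n\ge4$ and let $C_n$ be the cycle, viewed as the Cayley graph on $\mathbb{Z}_n$ with connection set $\{-1,1\}$, with Hamiltonian $M\in\{A,L,Q\}$. Let $1\le b\le n/2$ and $s\in\mathbb{R}\setminus\{0\}$. Perfect state transfer occurs from $\mathbf e_0+s\mathbf e_b$ to some $s$-pair state that is not a scalar multiple of $\mathbf e_0+s\mathbf e_b$ if and only if one of the following holds (the target and minimum time being as listed): (i) $n=4$: from $\mathbf e_0+s\mathbf e_1$ to $\mathbf e_2+s\mathbf e_3$, minimum time $\pi/2$, any $s\in\mathbb{R}\setminus\{0\}$; (ii) $n=4$: from $\mathbf e_0+s\mathbf e_2$ to $\mathbf e_2+s\mathbf e_0$, minimum time $\pi/2$, $s\in\mathbb{R}\setminus\{-1,0,1\}$; (iii) $n=4$: from $\mathbf e_0+\mathbf e_2$ to $\mathbf e_1+\mathbf e_3$, minimum time $\pi/4$; (iv) $n=6$: from $\mathbf e_0-\mathbf e_2$ to $\mathbf e_3-\mathbf e_5$, minimum time $\pi/2$; (v) $n=6$: from $\mathbf e_0+2\mathbf e_2$ to $\mathbf e_0+2\mathbf e_4$, minimum time $\pi$; (vi) $n=6$: from $\mathbf e_0+\tfrac12\mathbf e_2$ to $\mathbf e_4+\tfrac12\mathbf e_2$, minimum time $\pi$; (vii) $n=8$: from $\mathbf e_0-\mathbf e_2$ to $\mathbf e_4-\mathbf e_6$, minimum time $\pi/\sqrt2$; (viii) $n=8$: from $\mathbf e_0+\mathbf e_4$ to $\mathbf e_2+\mathbf e_6$, minimum ti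me $\pi/2$.
   Context: $U(t)=e^{-\mathrm{i}tM}$; perfect state transfer from $\mathbf u$ to $\boldsymbol\mu$ at time $\tau>0$ means $U(\tau)\mathbf u=\eta\boldsymbol\mu$ with $|\eta|=1$. An $s$-pair state is $\mathbf e_\alpha+s\mathbf e_\beta$ for distinct vertices $\alpha,\beta$ (same $s$ as the initial state). $A$, $L=D-A$, $Q=D+A$ are the adjacency, Laplacian and signless Laplacian matrices. *)

theory Defs
  imports "HOL-Analysis.Analysis"
begin

text \<open>Vertices of C_n are 0..n-1 (Z_n); vectors are functions nat => complex,
  only indices < n are relevant; matrices are nat => nat => complex.\<close>

definition cyc_adj :: "nat \<Rightarrow> nat \<Rightarrow> nat \<Rightarrow> complex" where
  "cyc_adj n i j = (if j = (i + 1) mod n \<or> i = (j + 1) mod n then 1 else 0)"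

text \<open>C_n is 2-regular, so D = 2 I.\<close>
definition cyc_deg :: "nat \<Rightarrow> nat \<Rightarrow> nat \<Rightarrow> complex" where
  "cyc_deg n i j = (if i = j then 2 else 0)"

definition cyc_lap :: "nat \<Rightarrow> nat \<Rightarrow> nat \<Rightarrow> complex" where
  "cyc_lap n i j = cyc_deg n i j - cyc_adj n i j"

definition cyc_slap :: "nat \<Rightarrow> nat \<Rightarrow> nat \<Rightarrow> complex" where
  "cyc_slap n i j = cyc_deg n i j + cyc_adj n i j"

definition mat_vec :: "nat \<Rightarrow> (nat \<Rightarrow> nat \<Rightarrow> complex) \<Rightarrow> (nat \<Rightarrow> complex) \<Rightarrow> nat \<Rightarrow> complex" where
  "mat_vec n M u = (\<lambda>i. \<Sum>j<n. M i j * u j)"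

fun mat_pow :: "nat \<Rightarrow> (nat \<Rightarrow> nat \<Rightarrow> complex) \<Rightarrow> nat \<Rightarrow> nat \<Rightarrow> nat \<Rightarrow> complex" where
  "mat_pow n M 0 = (\<lambda>i j. if i = j then 1 else 0)"
| "mat_pow n M (Suc k) = (\<lambda>i j. \<Sum>l<n. M i l * mat_pow n M k l j)"

text \<open>Perfect state transfer: U(tau) u = eta mu with |eta| = 1, tau > 0, where
  U(t) = exp(-i t M) is given by its (componentwise) exponential series.\<close>
definition pst :: "nat \<Rightarrow> (nat \<Rightarrow> nat \<Rightarrow> complex) \<Rightarrow> (nat \<Rightarrow> complex) \<Rightarrow> (nat \<Rightarrow> complex) \<Rightarrow> real \<Rightarrow> bool" where
  "pst n M u v \<tau> \<longleftrightarrow> \<tau> > 0 \<and> (\<exists>\<eta>::complex. cmod \<eta> = 1 \<and>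
     (\<forall>i<n. (\<lambda>k. ((- \<i> * complex_of_real \<tau>) ^ k / of_nat (fact k)) * mat_vec n (mat_pow n M k) u i)
              sums (\<eta> * v i)))"

definition pair_state :: "real \<Rightarrow> nat \<Rightarrow> nat \<Rightarrow> nat \<Rightarrow> complex" where
  "pair_state s \<alpha> \<beta> = (\<lambda>i. (if i = \<alpha> then 1 else 0) + (if i = \<beta> then complex_of_real s else 0))"

definition is_s_pair_state :: "nat \<Rightarrow> real \<Rightarrow> (nat \<Rightarrow> complex) \<Rightarrow> bool" where
  "is_s_pair_state n s v \<longleftrightarrow> (\<exists>\<alpha> \<beta>. \<alpha> < n \<and> \<beta> < n \<and> \<alpha> \<noteq> \<beta> \<and> v = pair_state s \<alpha> \<beta>)"

definition scalar_multiple :: "nat \<Rightarrow> (nat \<Rightarrow> complex) \<Rightarrow> (nat \<Rightarrow> complex) \<Rightarrow> bool" where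
  "scalar_multiple n v w \<longleftrightarrow> (\<exists>c::complex. \<forall>i<n. v i = c * w i)"

definition pair_pst :: "nat \<Rightarrow> (nat \<Rightarrow> nat \<Rightarrow> complex) \<Rightarrow> real \<Rightarrow> nat \<Rightarrow> (nat \<Rightarrow> complex) \<Rightarrow> real \<Rightarrow> bool" where
  "pair_pst n M s b v \<tau> \<longleftrightarrow> is_s_pair_state n s v \<and> \<not> scalar_multiple n v (pair_state s 0 b)
     \<and> pst n M (pair_state s 0 b) v \<tau>"

definition listed_case :: "nat \<Rightarrow> nat \<Rightarrow> real \<Rightarrow> (nat \<Rightarrow> complex) \<Rightarrow> real \<Rightarrow> bool" where
  "listed_case n b s w \<tau>0 \<longleftrightarrow>
     (n = 4 \<and> b = 1 \<and> w = pair_state s 2 3 \<and> \<tau>0 = pi / 2)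
   \<or> (n = 4 \<and> b = 2 \<and> s \<notin> {-1, 0, 1} \<and> w = pair_state s 2 0 \<and> \<tau>0 = pi / 2)
   \<or> (n = 4 \<and> b = 2 \<and> s = 1 \<and> w = pair_state s 1 3 \<and> \<tau>0 = pi / 4)
   \<or> (n = 6 \<and> b = 2 \<and> s = -1 \<and> w = pair_state s 3 5 \<and> \<tau>0 = pi / 2)
   \<or> (n = 6 \<and> b = 2 \<and> s = 2 \<and> w = pair_state s 0 4 \<and> \<tau>0 = pi)
   \<or> (n = 6 \<and> b = 2 \<and> s = 1 / 2 \<and> w = pair_state s 4 2 \<and> \<tau>0 = pi)
   \<or> (n = 8 \<and> b = 2 \<and> s = -1 \<and> w = pair_state s 4 6 \<and> \<tau>0 = pi / sqrt 2)
   \<or> (n = 8 \<and> b = 4 \<and> s = 1 \<and> w = pair_state s 2 6 \<and> \<tau>0 = pi / 2)"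

end

theory Submission
  imports Defs "HOL-Computational_Algebra.Polynomial"
begin

text \<open>
  The Fourier transform diagonalises the three Hamiltonians, so transfer at time \<open>\<tau>\<close> means
  \<open>cis (- 2 \<tau> c\<^sub>k) u\<^sub>k = \<eta> v\<^sub>k\<close> for all \<open>k\<close>, where \<open>c\<^sub>k = cos (2 \<pi> k / n)\<close> and \<open>u\<close>, \<open>v\<close> are the transforms
  of the two pair states; passing from \<open>A\<close> to \<open>L\<close> or \<open>Q\<close> only conjugates the equations or changes \<open>\<eta>\<close>.
  Multiplying the equations for \<open>k\<close> and \<open>-k\<close> shows that the differences of the \<open>c\<^sub>k\<close> with \<open>u\<^sub>k \<noteq> 0\<close> are
  rational multiples of one real number.  Four frequencies of this kind in arithmetic progression with
  difference \<open>j\<close> force \<open>c\<^sub>j\<close> to be rational, and Niven's theorem leaves finitely many \<open>n\<close>.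
  Comparing norms at \<open>k = 1\<close>, the target arises from the initial state by a rotation or a reflection of
  the cycle.  For a rotation by \<open>\<alpha>\<close> the equation at \<open>k\<close> gives \<open>n dvd 2 \<alpha> k\<close>, so it is the half turn as soon
  as \<open>u\<^sub>1 \<noteq> 0\<close>; the remaining phases are then compared by parity.  A reflection is governed
  by a quadratic equation in \<open>s\<close>.
\<close>

section \<open>Fourier transform on the cycle\<close>

definition chi :: "nat \<Rightarrow> int \<Rightarrow> complex" where
  "chi n k = cis (2 * pi * of_int k / of_nat n)"

definition cosine :: "nat \<Rightarrow> int \<Rightarrow> real" where
  "cosine n k = cos (2 * pi * of_int k / of_nat n)"

text \<open>Frequencies are arbitrary integers, so that \<open>k\<close> and \<open>- k\<close> can
  be compared without reduction mod \<open>n\<close>.\<close>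

definition fourier :: "nat \<Rightarrow> (nat \<Rightarrow> complex) \<Rightarrow> int \<Rightarrow> complex" where
  "fourier n x k = (\<Sum>j<n. chi n (k * int j) * x j)"

lemma chi_add: "chi n (k + l) = chi n k * chi n l"
  by (simp add: chi_def cis_mult add_divide_distrib distrib_left)

lemma chi_0 [simp]: "chi n 0 = 1"
  by (simp add: chi_def)

lemma norm_chi [simp]: "cmod (chi n k) = 1"
  by (simp add: chi_def)

lemma chi_nonzero [simp]: "chi n k \<noteq> 0"
  by (simp add: chi_def)

lemma cnj_chi: "cnj (chi n k) = chi n (- k)"
  by (simp add: chi_def cis_cnj)

lemma chi_minus_mult [simp]: "chi n (- k) * chi n k = 1" "chi n k * chi n (- k) = 1"
  by (simp_all flip: chi_add)

lemma chi_power: "chi n k ^ l = chi n (k * int l)"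
  by (induction l) (simp_all add: chi_add algebra_simps)

lemma chi_eq_1_iff:
  assumes "n > 0"
  shows "chi n k = 1 \<longleftrightarrow> int n dvd k"
proof
  assume "chi n k = 1"
  then have "cos (2 * pi * of_int k / of_nat n) = 1"
    by (simp add: chi_def complex_eq_iff)
  then obtain m :: int where "2 * pi * of_int k / of_nat n = of_int m * 2 * pi"
    using cos_one_2pi_int by blast
  then have "real_of_int k = of_int (int n * m)"
    using assms by (simp add: field_simps)
  then show "int n dvd k"
    by (metis dvd_triv_left of_int_eq_iff)
next
  assume "int n dvd k"
  then obtain m where "k = int n * m" ..
  then have "2 * pi * of_int k / of_nat n = 2 * pi * of_int m"
    using assms by simp
  then show "chi n k = 1"
    by (simp only: chi_def cis_multiple_2pi Ints_of_int)
qed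

lemma chi_cong:
  assumes "n > 0" "int n dvd k - l"
  shows "chi n k = chi n l"
  using chi_add[of n "k - l" l] chi_eq_1_iff[of n "k - l"] assms by simp

lemma chi_mod:
  assumes "n > 0"
  shows "chi n (k * (l mod int n)) = chi n (k * l)" "chi n ((l mod int n) * k) = chi n (l * k)"
  by (rule chi_cong[OF assms], simp add: mod_eq_dvd_iff mod_simps flip: mod_eq_dvd_iff)+

lemma chi_eq_cosine: "chi n k + chi n (- k) = of_real (2 * cosine n k)"
  by (simp add: chi_def cosine_def complex_eq_iff)

lemma cosine_eq_Re: "cosine n k = Re (chi n k)"
  by (simp add: chi_def cosine_def)

lemma cosine_minus [simp]: "cosine n (- k) = cosine n k"
  by (simp add: cosine_def)

lemma sum_chi:
  assumes "n > 0"
  shows "(\<Sum>k<n. chi n (int k * l)) = (if int n dvd l then of_nat n else 0)"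
proof (cases "int n dvd l")
  case True
  then have "chi n (int k * l) = 1" for k
    using chi_eq_1_iff[OF assms] by simp
  with True show ?thesis by simp
next
  case False
  then have "chi n l \<noteq> 1"
    using chi_eq_1_iff[OF assms] by simp
  moreover have "chi n l ^ n = 1"
    using chi_eq_1_iff[OF assms] by (simp add: chi_power)
  ultimately have "(\<Sum>k<n. chi n l ^ k) = 0"
    by (simp add: geometric_sum)
  with False show ?thesis by (simp add: chi_power mult.commute)
qed

lemma fourier_inversion:
  assumes "n > 0" "i < n"
  shows "(\<Sum>k<n. chi n (- int k * int i) * fourier n x (int k)) = of_nat n * x i"
proof -
  have "(\<Sum>k<n. chi n (- int k * int i) * fourier n x (int k))
      = (\<Sum>k<n. \<Sum>j<n. chi n (int k * (int j - int i)) * x j)"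
    unfolding fourier_def sum_distrib_left
    by (intro sum.cong refl) (simp add: algebra_simps flip: chi_add)
  also have "\<dots> = (\<Sum>j<n. (\<Sum>k<n. chi n (int k * (int j - int i))) * x j)"
    by (subst sum.swap) (simp add: sum_distrib_right)
  also have "\<dots> = (\<Sum>j<n. if j = i then of_nat n * x i else 0)"
  proof (intro sum.cong refl)
    fix j assume "j \<in> {..<n}"
    then have "int n dvd int j - int i \<longleftrightarrow> j = i"
      using assms(2) by (simp add: flip: mod_eq_dvd_iff zmod_int)
    then show "(\<Sum>k<n. chi n (int k * (int j - int i))) * x j = (if j = i then of_nat n * x i else 0)"
      by (simp add: sum_chi[OF assms(1)])
  qed
  also have "\<dots> = of_nat n * x i"
    using assms(2) by simp
  finally show ?thesis .
qed

text \<open>Column \<open>j\<close> has its ones in the rows of the two neighbours of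
  \<open>j\<close>, distinct since \<open>n \<ge> 3\<close>; they contribute the factors
  \<open>chi n k\<close> and \<open>chi n (- k)\<close>. The character multiplies from the left, as
  the transform of \<open>mat_vec\<close> requires.\<close>

lemma cyc_adj_eigen:
  assumes "n \<ge> 3" "j < n"
  shows "(\<Sum>i<n. chi n (k * int i) * cyc_adj n i j) = 2 * cosine n k * chi n (k * int j)"
proof -
  \<comment> \<open>Adding \<open>n\<close> first keeps the predecessor of 0 from being truncated by
    natural subtraction.\<close>
  let ?p = "(j + 1) mod n" and ?q = "(j + n - 1) mod n"
  have q: "?q = (if j = 0 then n - 1 else j - 1)"
    using assms by (auto simp: mod_if)
  have p: "?p = (if j = n - 1 then 0 else j + 1)"
    using assms by auto
  have "?p \<noteq> ?q" unfolding p q using assms by auto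
  have adj: "cyc_adj n i j = (if i = ?p \<or> i = ?q then 1 else 0)" if "i < n" for i
  proof -
    have "j = (i + 1) mod n \<longleftrightarrow> i = ?q"
      unfolding q using assms that by (auto simp: mod_if)
    then show ?thesis by (auto simp: cyc_adj_def)
  qed
  have "(\<Sum>i<n. chi n (k * int i) * cyc_adj n i j) = (\<Sum>i\<in>{?p, ?q}. chi n (k * int i))"
    using assms by (intro sum.mono_neutral_cong_right) (auto simp: adj)
  also have "\<dots> = chi n (k * int ?p) + chi n (k * int ?q)"
    using \<open>?p \<noteq> ?q\<close> by simp
  also have "chi n (k * int ?p) = chi n (k * int j) * chi n k"
    using assms by (simp only: zmod_int) (simp add: chi_mod algebra_simps chi_add)
  also have "chi n (k * int ?q) = chi n (k * int j) * chi n (- k)"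
  proof -
    have "int (j + n - 1) = int j + int n - 1" using assms by simp
    then have "chi n (k * int ?q) = chi n (k * (int j + int n - 1))"
      using assms by (simp only: zmod_int) (simp add: chi_mod)
    also have "\<dots> = chi n (k * int j + (- k))"
      using assms by (intro chi_cong) (auto simp: algebra_simps)
    finally show ?thesis by (simp only: chi_add)
  qed
  also have "chi n (k * int j) * chi n k + chi n (k * int j) * chi n (- k)
      = chi n (k * int j) * (chi n k + chi n (- k))"
    by (simp only: distrib_left)
  finally show ?thesis
    by (simp add: chi_eq_cosine mult_ac)
qed

lemma mat_vec_mat_pow_Suc:
  "mat_vec n (mat_pow n M (Suc r)) u i = mat_vec n M (mat_vec n (mat_pow n M r) u) i"
proof -
  have "mat_vec n (mat_pow n M (Suc r)) u i = (\<Sum>j<n. \<Sum>l<n. M i l * (mat_pow n M r l j * u j))"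
    by (simp add: mat_vec_def sum_distrib_right mult.assoc)
  also have "\<dots> = (\<Sum>l<n. \<Sum>j<n. M i l * (mat_pow n M r l j * u j))"
    by (rule sum.swap)
  finally show ?thesis
    by (simp add: mat_vec_def sum_distrib_left)
qed

text \<open>The pair \<open>(a, c)\<close> is (0, 1) for A, (2, -1) for L and (2, 1) for Q.\<close>

definition eigenvalue :: "nat \<Rightarrow> real \<Rightarrow> real \<Rightarrow> int \<Rightarrow> real" where
  "eigenvalue n a c k = a + c * (2 * cosine n k)"

section \<open>Evolution under a Hamiltonian of the form a I + c A\<close>

context
  fixes n :: nat and a c :: real and M :: "nat \<Rightarrow> nat \<Rightarrow> complex"
  assumes n_ge_3: "n \<ge> 3"
    and M_eq: "M = (\<lambda>i j. (if i = j then of_real a else 0) + of_real c * cyc_adj n i j)"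
begin

lemma column_eigen:
  assumes "j < n"
  shows "(\<Sum>i<n. chi n (k * int i) * M i j) = eigenvalue n a c k * chi n (k * int j)"
proof -
  have "(\<Sum>i<n. chi n (k * int i) * M i j)
      = (\<Sum>i<n. if i = j then of_real a * chi n (k * int i) else 0)
        + of_real c * (\<Sum>i<n. chi n (k * int i) * cyc_adj n i j)"
    unfolding sum_distrib_left sum.distrib[symmetric] M_eq
    by (intro sum.cong refl) (simp add: algebra_simps)
  then show ?thesis
    using assms by (simp add: cyc_adj_eigen[OF n_ge_3] eigenvalue_def ring_distribs mult.assoc)
qed

lemma fourier_mat_vec: "fourier n (mat_vec n M x) k = eigenvalue n a c k * fourier n x k"
proof -
  have "fourier n (mat_vec n M x) k = (\<Sum>i<n. \<Sum>j<n. chi n (k * int i) * M i j * x j)"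
    by (simp add: fourier_def mat_vec_def sum_distrib_left mult.assoc)
  also have "\<dots> = (\<Sum>j<n. (\<Sum>i<n. chi n (k * int i) * M i j) * x j)"
    by (subst sum.swap) (simp add: sum_distrib_right)
  also have "\<dots> = (\<Sum>j<n. eigenvalue n a c k * chi n (k * int j) * x j)"
    by (intro sum.cong refl) (simp add: column_eigen)
  finally show ?thesis
    by (simp add: fourier_def sum_distrib_left mult.assoc)
qed

lemma fourier_mat_pow:
  "fourier n (mat_vec n (mat_pow n M r) u) k = of_real (eigenvalue n a c k) ^ r * fourier n u k"
proof (induction r)
  case 0
  have "mat_vec n (mat_pow n M 0) u i = u i" if "i < n" for i
    using that by (simp add: mat_vec_def if_distrib[of "\<lambda>x. x * _"] cong: if_cong)
  then show ?case by (simp add: fourier_def)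
next
  case (Suc r)
  have "mat_vec n (mat_pow n M (Suc r)) u = mat_vec n M (mat_vec n (mat_pow n M r) u)"
    using mat_vec_mat_pow_Suc by (intro ext)
  then show ?case
    by (simp add: fourier_mat_vec Suc.IH del: mat_pow.simps)
qed

abbreviation exp_series :: "real \<Rightarrow> (nat \<Rightarrow> complex) \<Rightarrow> nat \<Rightarrow> nat \<Rightarrow> complex" where
  "exp_series t u i \<equiv>
     (\<lambda>r. ((- \<i> * complex_of_real t) ^ r / of_nat (fact r)) * mat_vec n (mat_pow n M r) u i)"

lemma exp_eigenvalue_sums:
  "(\<lambda>r. ((- \<i> * complex_of_real t) ^ r / of_nat (fact r)) * of_real (eigenvalue n a c k) ^ r)
     sums cis (- t * eigenvalue n a c k)"
proof -
  have "(\<lambda>r. (- \<i> * complex_of_real t * of_real (eigenvalue n a c k)) ^ r /\<^sub>R fact r)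
     sums exp (- \<i> * complex_of_real t * of_real (eigenvalue n a c k))"
    by (rule exp_converges)
  moreover have "exp (- \<i> * complex_of_real t * of_real (eigenvalue n a c k)) = cis (- t * eigenvalue n a c k)"
    by (simp add: cis_conv_exp mult.assoc)
  moreover have "(- \<i> * complex_of_real t * of_real (eigenvalue n a c k)) ^ r /\<^sub>R fact r
      = ((- \<i> * complex_of_real t) ^ r / of_nat (fact r)) * of_real (eigenvalue n a c k) ^ r" for r
    by (simp only: power_mult_distrib scaleR_conv_of_real) (simp add: field_simps)
  ultimately show ?thesis by simp
qed

text \<open>Fourier inversion writes each entry of the r-th power applied to \<open>u\<close> as a
  finite sum over frequencies, so the matrix series splits into scalar exponential series.\<close>

lemma exp_series_sums:
  assumes "i < n"
  shows "exp_series t u i sums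
    ((\<Sum>k<n. chi n (- int k * int i) * (cis (- t * eigenvalue n a c (int k)) * fourier n u (int k))) / of_nat n)"
proof -
  have n: "n > 0" using n_ge_3 by simp
  let ?e = "\<lambda>r. (- \<i> * complex_of_real t) ^ r / of_nat (fact r)"
  have "(\<lambda>r. (\<Sum>k<n. chi n (- int k * int i) * ((?e r * of_real (eigenvalue n a c (int k)) ^ r) * fourier n u (int k))) / of_nat n)
    sums ((\<Sum>k<n. chi n (- int k * int i) * (cis (- t * eigenvalue n a c (int k)) * fourier n u (int k))) / of_nat n)"
    by (intro sums_divide sums_sum sums_mult sums_mult2 exp_eigenvalue_sums)
  moreover have "(\<Sum>k<n. chi n (- int k * int i) * ((?e r * of_real (eigenvalue n a c (int k)) ^ r) * fourier n u (int k))) / of_nat n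
    = ?e r * mat_vec n (mat_pow n M r) u i" for r
  proof -
    have "of_nat n * mat_vec n (mat_pow n M r) u i
      = (\<Sum>k<n. chi n (- int k * int i) * (of_real (eigenvalue n a c (int k)) ^ r * fourier n u (int k)))"
      using fourier_inversion[OF n assms, of "mat_vec n (mat_pow n M r) u"] by (simp add: fourier_mat_pow)
    then have "?e r * (of_nat n * mat_vec n (mat_pow n M r) u i)
      = (\<Sum>k<n. chi n (- int k * int i) * ((?e r * of_real (eigenvalue n a c (int k)) ^ r) * fourier n u (int k)))"
      by (simp only: sum_distrib_left) (intro sum.cong refl, simp only: ac_simps)
    from this[symmetric] show ?thesis
      by (rule ssubst) (use n in simp)
  qed
  ultimately show ?thesis by (simp only:)
qed

text \<open>The transform is a finite sum and may be taken term by term; uniqueness of limits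
  compares the result with the scalar exponential series.\<close>

lemma fourier_of_pst:
  assumes "\<And>i. i < n \<Longrightarrow> exp_series t u i sums (\<eta> * v i)"
  shows "cis (- t * eigenvalue n a c k) * fourier n u k = \<eta> * fourier n v k"
proof -
  let ?e = "\<lambda>r. (- \<i> * complex_of_real t) ^ r / of_nat (fact r)"
  have "(\<lambda>r. \<Sum>i<n. chi n (k * int i) * (?e r * mat_vec n (mat_pow n M r) u i))
     sums (\<Sum>i<n. chi n (k * int i) * (\<eta> * v i))"
    by (intro sums_sum sums_mult assms) auto
  moreover have "(\<Sum>i<n. chi n (k * int i) * (?e r * mat_vec n (mat_pow n M r) u i))
      = ?e r * of_real (eigenvalue n a c k) ^ r * fourier n u k" for r
  proof -
    have "(\<Sum>i<n. chi n (k * int i) * (?e r * mat_vec n (mat_pow n M r) u i))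
      = ?e r * fourier n (mat_vec n (mat_pow n M r) u) k"
      unfolding fourier_def sum_distrib_left by (intro sum.cong refl) (simp only: ac_simps)
    then show ?thesis by (simp only: fourier_mat_pow mult.assoc)
  qed
  ultimately have "(\<lambda>r. ?e r * of_real (eigenvalue n a c k) ^ r * fourier n u k)
     sums (\<Sum>i<n. chi n (k * int i) * (\<eta> * v i))"
    by (simp only:)
  moreover have "(\<lambda>r. ?e r * of_real (eigenvalue n a c k) ^ r * fourier n u k)
     sums (cis (- t * eigenvalue n a c k) * fourier n u k)"
    by (intro sums_mult2 exp_eigenvalue_sums)
  ultimately show ?thesis
    by (simp add: sums_unique2 fourier_def sum_distrib_left mult_ac)
qed

text \<open>From here on matrices and series are replaced by one scalar equation per
  frequency.\<close>

lemma pst_iff_fourier: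
  "pst n M u v t \<longleftrightarrow> t > 0 \<and> (\<exists>\<eta>. cmod \<eta> = 1 \<and>
     (\<forall>k. cis (- t * eigenvalue n a c k) * fourier n u k = \<eta> * fourier n v k))"
  (is "_ \<longleftrightarrow> _ \<and> (\<exists>\<eta>. _ \<and> (\<forall>k. ?F \<eta> k))")
proof -
  have n: "n > 0" using n_ge_3 by simp
  have "(\<forall>i<n. exp_series t u i sums (\<eta> * v i)) \<longleftrightarrow> (\<forall>k. ?F \<eta> k)" for \<eta>
  proof
    assume "\<forall>k. ?F \<eta> k"
    then have *: "cis (- t * eigenvalue n a c k) * fourier n u k = \<eta> * fourier n v k" for k by blast
    show "\<forall>i<n. exp_series t u i sums (\<eta> * v i)"
    proof (intro allI impI)
      fix i assume i: "i < n"
      have "(\<Sum>k<n. chi n (- int k * int i) * (cis (- t * eigenvalue n a c (int k)) * fourier n u (int k)))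
        = \<eta> * (\<Sum>k<n. chi n (- int k * int i) * fourier n v (int k))"
        unfolding * sum_distrib_left by (intro sum.cong refl) (simp only: ac_simps)
      also have "\<dots> = of_nat n * (\<eta> * v i)"
        by (simp only: fourier_inversion[OF n i] mult.left_commute)
      finally show "exp_series t u i sums (\<eta> * v i)"
        using exp_series_sums[OF i, of t u] n by simp
    qed
  qed (blast intro: fourier_of_pst)
  then show ?thesis by (simp only: pst_def)
qed

end

section \<open>Rational dependence of cosine differences\<close>

text \<open>Twice the difference of the cosines factors as
  \<open>(chi n k - chi n j) * (1 - chi n (- k - j))\<close>; each factor accounts for one
  divisibility.\<close>

lemma cosine_eq_iff:
  assumes "n > 0"
  shows "cosine n k = cosine n j \<longleftrightarrow> int n dvd k - j \<or> int n dvd k + j"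
proof -
  have "(chi n k - chi n j) * (1 - chi n (- k) * chi n (- j))
      = (chi n k + chi n (- k)) - (chi n j + chi n (- j))"
    by (simp add: algebra_simps flip: chi_add)
  also have "\<dots> = of_real (2 * (cosine n k - cosine n j))"
    by (simp add: chi_eq_cosine)
  finally have "cosine n k = cosine n j \<longleftrightarrow> chi n k = chi n j \<or> chi n (- k - j) = 1"
    by (auto simp flip: chi_add)
  moreover have "chi n k = chi n j \<longleftrightarrow> chi n (k - j) = 1"
    using chi_add[of n "k - j" j] by simp
  moreover have "int n dvd - k - j \<longleftrightarrow> int n dvd k + j"
    using dvd_minus_iff[of "int n" "k + j"] by simp
  ultimately show ?thesis
    by (simp add: chi_eq_1_iff[OF assms])
qed

lemma cosine_0 [simp]: "cosine n 0 = 1"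
  by (simp add: cosine_def)

lemma cosine_double: "cosine n (2 * k) = 2 * (cosine n k)\<^sup>2 - 1"
  using cos_double_cos[of "2 * pi * of_int k / of_nat n"] by (simp add: cosine_def mult_ac)

lemma cosine_add_cosine_diff: "cosine n (k + j) + cosine n (k - j) = 2 * cosine n k * cosine n j"
  by (simp add: cosine_def distrib_left right_diff_distrib add_divide_distrib diff_divide_distrib
      cos_add cos_diff)

lemma cosine_mult_cancel: "h > 0 \<Longrightarrow> cosine (h * n) (int h * k) = cosine n k"
  by (simp add: cosine_def mult.assoc)

section \<open>Niven's theorem on rational cosines\<close>

lemma monic_chebyshev_poly:
  "\<exists>p :: real poly. (\<forall>i. coeff p i \<in> \<int>) \<and> degree p = Suc m \<and> lead_coeff p = 1
     \<and> (\<forall>x. poly p (2 * cos x) = 2 * cos (real (Suc m) * x))"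
\<comment> \<open>Degrees start at 1 because \<open>2 * cos (0 * x)\<close> is the constant 2, which
  is not monic.\<close>
proof (induction m rule: induct_nat_012)
  case 0
  have "coeff [:0, 1 :: real:] i \<in> \<int>" for i
    by (auto simp: coeff_pCons split: nat.split)
  then show ?case by (intro exI[of _ "[:0, 1:]"]) auto
next
  case 1
  have "coeff [:-2, 0, 1 :: real:] i \<in> \<int>" for i
    by (auto simp: coeff_pCons split: nat.split)
  then show ?case
    by (intro exI[of _ "[:-2, 0, 1:]"]) (auto simp: cos_double_cos power2_eq_square)
next
  case (ge2 m)
  then obtain p q :: "real poly" where
    p: "\<forall>i. coeff p i \<in> \<int>" "degree p = Suc m" "\<forall>x. poly p (2 * cos x) = 2 * cos (real (Suc m) * x)"
    and q: "\<forall>i. coeff q i \<in> \<int>" "degree q = Suc (Suc m)" "lead_coeff q = 1"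
      "\<forall>x. poly q (2 * cos x) = 2 * cos (real (Suc (Suc m)) * x)"
    by blast
  have q0: "q \<noteq> 0" using q(3) by auto
  have deg: "degree (pCons 0 q) = Suc (Suc (Suc m))"
    using q0 q(2) by simp
  have deg': "degree (pCons 0 q - p) = Suc (Suc (Suc m))"
    using degree_add_eq_left[of "- p" "pCons 0 q"] p(2) deg by simp
  have "coeff (pCons 0 q - p) (Suc (Suc (Suc m))) = 1"
    using q(2,3) p(2) by (simp add: coeff_eq_0)
  moreover have "coeff (pCons 0 q - p) i \<in> \<int>" for i
    using p(1) q(1) by (auto simp: coeff_pCons split: nat.split)
  \<comment> \<open>\<open>pCons 0 q\<close> is X q; the recurrence X q - p comes from adding the
    formulas for \<open>cos (y + x)\<close> and \<open>cos (y - x)\<close>.\<close>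
  moreover have "poly (pCons 0 q - p) (2 * cos x) = 2 * cos (real (Suc (Suc (Suc m))) * x)" for x
  proof -
    have "2 * cos (real (Suc (Suc m)) * x + x)
        = 4 * (cos x * cos (real (Suc (Suc m)) * x)) - 2 * cos (real (Suc (Suc m)) * x - x)"
      by (simp add: cos_add cos_diff)
    moreover have "real (Suc (Suc m)) * x + x = real (Suc (Suc (Suc m))) * x"
      "real (Suc (Suc m)) * x - x = real (Suc m) * x"
      by (simp_all add: algebra_simps)
    ultimately show ?thesis
      using p(3) q(4) by (simp del: of_nat_Suc)
  qed
  ultimately show ?case
    using deg' by (intro exI[of _ "pCons 0 q - p"]) auto
qed

text \<open>At the angle \<open>2 * pi / n\<close> the monic polynomial of degree \<open>n\<close>
  takes the value \<open>2 * cos (2 * pi)\<close>, so subtracting 2 gives an integral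
  equation.\<close>

lemma algebraic_int_2_cosine:
  assumes "n > 0"
  shows "algebraic_int (2 * cosine n 1)"
proof -
  obtain p :: "real poly" where p: "\<forall>i. coeff p i \<in> \<int>" "degree p = n" "lead_coeff p = 1"
      "\<forall>x. poly p (2 * cos x) = 2 * cos (real n * x)"
    using monic_chebyshev_poly[of "n - 1"] assms by auto
  have deg: "degree (p + [:- 2:]) = n"
    using degree_add_eq_left[of "[:- 2:]" p] p(2) assms by simp
  show ?thesis
  proof (rule algebraic_int.intros)
    show "lead_coeff (p + [:- 2:]) = 1"
      using p assms unfolding deg by (cases n) auto
    show "\<forall>i. coeff (p + [:- 2:]) i \<in> \<int>"
      using p(1) by (auto simp: coeff_pCons split: nat.split)
    show "poly (p + [:- 2:]) (2 * cosine n 1) = 0"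
      using p(4) assms by (simp add: cosine_def)
  qed
qed

text \<open>A rational algebraic integer is an integer. For \<open>n \<ge> 5\<close> the number
  \<open>2 * cosine n 1\<close> lies strictly between 0 and 2, so it is 1 and the cosine is that of
  \<open>pi / 3\<close>; monotonicity excludes \<open>n = 5\<close> from one side and
  \<open>n > 6\<close> from the other.\<close>

lemma niven:
  assumes "n > 0" "cosine n 1 \<in> \<rat>"
  shows "n \<in> {1, 2, 3, 4, 6}"
proof (rule ccontr)
  assume n: "n \<notin> {1, 2, 3, 4, 6}"
  have "2 * cosine n 1 \<in> \<int>"
    using rational_algebraic_int_is_int[OF algebraic_int_2_cosine] assms by simp
  then obtain m :: int where m: "2 * cosine n 1 = of_int m"
    by (auto elim: Ints_cases)
  have "n \<ge> 5" using n assms(1) by auto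
  have "0 < cosine n 1"
  proof -
    have "- (pi / 2) < 0" by simp
    also have "0 < 2 * pi / n" using assms(1) by simp
    finally show ?thesis
      unfolding cosine_def using \<open>n \<ge> 5\<close> by (intro cos_gt_zero_pi) (simp_all add: field_simps)
  qed
  moreover have "cosine n 1 < 1"
  proof -
    have "cosine n 1 < cos 0"
      unfolding cosine_def using n assms(1) by (intro cos_monotone_0_pi) (auto simp: field_simps)
    then show ?thesis by simp
  qed
  ultimately have "m = 1" using m by linarith
  then have half: "cosine n 1 = cos (pi / 3)" using m by (simp add: cos_60)
  show False
  proof (cases "n = 5")
    case True
    have "cosine n 1 < cos (pi / 3)"
      unfolding cosine_def True by (intro cos_monotone_0_pi) auto
    then show False using half by simp
  next
    case False
    then have "n > 6" using n assms(1) by auto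
    then have "cos (pi / 3) < cosine n 1"
      unfolding cosine_def by (intro cos_monotone_0_pi) (auto simp: field_simps)
    then show False using half by simp
  qed
qed

text \<open>The scale \<open>D\<close> absorbs the unknown transfer time; what survives is the
  rationality of quotients of differences.\<close>

definition commensurable :: "nat \<Rightarrow> int set \<Rightarrow> bool" where
  "commensurable n S \<longleftrightarrow> (\<exists>D. D \<noteq> 0 \<and> (\<forall>k\<in>S. \<forall>j\<in>S. D * (cosine n k - cosine n j) \<in> \<rat>))"

lemma commensurable_subset: "commensurable n S \<Longrightarrow> T \<subseteq> S \<Longrightarrow> commensurable n T"
  unfolding commensurable_def by blast

lemma commensurable_ratio:
  assumes "commensurable n S" "{i, j, k, l} \<subseteq> S"
  shows "(cosine n i - cosine n j) / (cosine n k - cosine n l) \<in> \<rat>"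
proof -
  obtain D where D: "D \<noteq> 0" "\<forall>k\<in>S. \<forall>j\<in>S. D * (cosine n k - cosine n j) \<in> \<rat>"
    using assms(1) unfolding commensurable_def by blast
  \<comment> \<open>A vanishing denominator makes the quotient 0, which is rational too.\<close>
  then have "(D * (cosine n i - cosine n j)) / (D * (cosine n k - cosine n l)) \<in> \<rat>"
    using assms(2) by (intro Rats_divide) auto
  then show ?thesis using D(1) by simp
qed

text \<open>Adding the recurrence \<open>c\<^sub>k\<^sub>+\<^sub>j + c\<^sub>k\<^sub>-\<^sub>j = 2 c\<^sub>j c\<^sub>k\<close> at the two inner terms with opposite
  signs leaves \<open>2 c\<^sub>j\<close> as a quotient of differences.\<close>
lemma commensurable_progression:
  assumes "commensurable n S" "{i, i + j, i + 2 * j, i + 3 * j} \<subseteq> S"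
    and "cosine n (i + j) \<noteq> cosine n (i + 2 * j)"
  shows "cosine n j \<in> \<rat>"
proof -
  define d where "d = cosine n (i + j) - cosine n (i + 2 * j)"
  have d: "d \<noteq> 0" using assms(3) by (simp add: d_def)
  have "2 * cosine n j * d
      = (cosine n i - cosine n (i + j)) + (cosine n (i + 2 * j) - cosine n (i + 3 * j))"
    using cosine_add_cosine_diff[of n "i + j" j] cosine_add_cosine_diff[of n "i + 2 * j" j]
    by (simp add: d_def algebra_simps)
  then have eq: "cosine n j = ((cosine n i - cosine n (i + j)) / d
      + (cosine n (i + 2 * j) - cosine n (i + 3 * j)) / d) / 2"
    using d by (simp add: nonzero_eq_divide_eq mult_ac flip: add_divide_distrib)
  show ?thesis
    unfolding eq d_def
    by (intro Rats_divide Rats_add commensurable_ratio[OF assms(1)]) (use assms(2) in auto)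
qed

text \<open>By the double angle formula the difference at the doubled frequencies is
  \<open>2 * (cosine n i + cosine n j)\<close> times the original difference.\<close>

lemma commensurable_doubling:
  assumes "commensurable n S" "{i, j, 2 * i, 2 * j} \<subseteq> S" "cosine n i \<noteq> cosine n j"
  shows "cosine n i + cosine n j \<in> \<rat>"
proof -
  have "(cosine n (2 * i) - cosine n (2 * j)) / (cosine n i - cosine n j) \<in> \<rat>"
    using assms(2) by (intro commensurable_ratio[OF assms(1)]) auto
  also have "cosine n (2 * i) - cosine n (2 * j)
      = 2 * (cosine n i + cosine n j) * (cosine n i - cosine n j)"
    unfolding cosine_double by (simp add: power2_eq_square algebra_simps)
  finally have "2 * (cosine n i + cosine n j) \<in> \<rat>"
    using assms(3) by simp
  then have "2 * (cosine n i + cosine n j) / 2 \<in> \<rat>"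
    by (intro Rats_divide) auto
  moreover have "2 * (cosine n i + cosine n j) / 2 = cosine n i + cosine n j"
    by (rule nonzero_mult_div_cancel_left) simp
  ultimately show ?thesis by (simp only:)
qed

section \<open>Cycle lengths compatible with commensurable frequencies\<close>

lemma not_int_dvd:
  "0 < k \<Longrightarrow> k < int n \<Longrightarrow> \<not> int n dvd k"
  by (simp add: zdvd_not_zless)

text \<open>The inner terms 0 and 1 of this progression have different cosines, so Niven's theorem
  applies to step 1.\<close>

lemma commensurable_around_0:
  assumes "commensurable n {- 1, 0, 1, 2}" "n \<ge> 4"
  shows "n \<in> {4, 6}"
proof -
  have "cosine n 0 \<noteq> cosine n 1"
    using assms(2) by (subst cosine_eq_iff) auto
  then have "cosine n 1 \<in> \<rat>"
    using commensurable_progression[OF assms(1), of "- 1" 1] by simp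
  then show ?thesis using niven[of n] assms(2) by auto
qed

text \<open>The inner terms 2 and 3 have equal cosines only if \<open>n\<close> divides their sum 5,
  whence the exception.\<close>

lemma commensurable_1_to_4:
  assumes "commensurable n {1, 2, 3, 4}" "n \<ge> 4" "n \<noteq> 5"
  shows "n \<in> {4, 6}"
proof -
  have "\<not> int n dvd 5"
  proof
    assume "int n dvd 5"
    then have "n dvd 5" by presburger
    then have "n \<le> 5" by (auto dest: dvd_imp_le)
    with assms have "n = 4" by simp
    with \<open>n dvd 5\<close> show False by simp
  qed
  then have "cosine n 2 \<noteq> cosine n 3"
    using assms(2) by (subst cosine_eq_iff) auto
  then have "cosine n 1 \<in> \<rat>"
    using commensurable_progression[OF assms(1), of 1 1] by simp
  then show ?thesis using niven[of n] assms(2) by auto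
qed

text \<open>Powers of 2 avoid the multiples of 3. Doubling makes the three pairwise sums of c_1,
  c_2, c_4 rational, and these sums determine c_1.\<close>

lemma commensurable_coprime_3:
  assumes "commensurable (3 * b) {1, 2, 4, 8}" "b \<ge> 2"
  shows "b = 2"
proof (rule ccontr)
  assume "b \<noteq> 2"
  then have b: "b \<ge> 3" using assms(2) by simp
  have ndvd: "\<not> int (3 * b) dvd k" if "k \<in> {-3, -2, -1, 3, 5, 6}" for k
  proof -
    have "\<not> int (3 * b) dvd \<bar>k\<bar>"
      using that b by (intro not_int_dvd) auto
    then show ?thesis by simp
  qed
  let ?c = "cosine (3 * b)"
  have "?c 1 \<noteq> ?c 2" "?c 1 \<noteq> ?c 4" "?c 2 \<noteq> ?c 4"
    using b ndvd[of "-1"] ndvd[of 3] ndvd[of "-3"] ndvd[of 5] ndvd[of "-2"] ndvd[of 6]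
    by (simp_all add: cosine_eq_iff)
  then have r: "?c 1 + ?c 2 \<in> \<rat>" "?c 1 + ?c 4 \<in> \<rat>" "?c 2 + ?c 4 \<in> \<rat>"
    using commensurable_doubling[OF assms(1)] by auto
  have "((?c 1 + ?c 2) + (?c 1 + ?c 4) - (?c 2 + ?c 4)) / 2 \<in> \<rat>"
    by (intro Rats_divide Rats_diff Rats_add r) auto
  then have "?c 1 \<in> \<rat>" by simp
  then have "3 * b \<in> {1, 2, 3, 4, 6}" using niven[of "3 * b"] b by simp
  with b show False by auto
qed

text \<open>Odd frequencies have step 2, and frequency 2 on \<open>4 * b\<close> vertices is
  frequency 1 on \<open>2 * b\<close> vertices, where Niven's theorem applies.\<close>

lemma commensurable_odd:
  assumes "commensurable (4 * b) {1, 3, 5, 7}" "b \<ge> 1"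
  shows "b \<in> {1, 2, 3}"
proof (rule ccontr)
  assume b: "b \<notin> {1, 2, 3}"
  then have "b > 3" using assms(2) by auto
  then have "\<not> int (4 * b) dvd 8" "\<not> int (4 * b) dvd 2"
    by (intro not_int_dvd; simp)+
  then have "cosine (4 * b) 3 \<noteq> cosine (4 * b) 5"
    using assms(2) by (simp add: cosine_eq_iff)
  then have "cosine (2 * (2 * b)) (int 2 * 1) \<in> \<rat>"
    using commensurable_progression[OF assms(1), of 1 2] by simp
  then have "cosine (2 * b) 1 \<in> \<rat>"
    by (subst (asm) cosine_mult_cancel) auto
  then have "2 * b \<in> {1, 2, 3, 4, 6}"
    using niven[of "2 * b"] assms(2) by auto
  with \<open>b > 3\<close> show False by auto
qed

text \<open>Step 2 on \<open>2 * b\<close> vertices is step 1 on \<open>b\<close> vertices, so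
  Niven's theorem restricts \<open>b\<close> itself.\<close>

lemma commensurable_even:
  assumes "commensurable (2 * b) {- 2, 0, 2, 4}" "b \<ge> 2"
  shows "b \<in> {2, 3, 4, 6}"
proof -
  have "\<not> int (2 * b) dvd 2"
    using assms(2) by (intro not_int_dvd) auto
  then have "cosine (2 * b) 0 \<noteq> cosine (2 * b) 2"
    using assms(2) by (subst cosine_eq_iff) auto
  then have "cosine (2 * b) (int 2 * 1) \<in> \<rat>"
    using commensurable_progression[OF assms(1), of "- 2" 2] by simp
  then have "cosine b 1 \<in> \<rat>"
    by (subst (asm) cosine_mult_cancel) auto
  then show ?thesis
    using niven[of b] assms(2) by auto
qed

text \<open>Both are algebraic integers, hence integers if rational, but they lie strictly between 1
  and 2.\<close>

lemma sqrt_2_irrational: "sqrt 2 \<notin> \<rat>"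
  and sqrt_3_irrational: "sqrt 3 \<notin> \<rat>"
proof -
  have *: "sqrt (real q) \<notin> \<rat>" if "q \<in> {2, 3}" for q
  proof
    assume "sqrt (real q) \<in> \<rat>"
    moreover have "algebraic_int (sqrt (real q))"
      by (rule algebraic_int.intros[of "[:- real q, 0, 1:]"])
         (auto simp: coeff_pCons split: nat.split)
    ultimately obtain m :: int where m: "sqrt (real q) = of_int m"
      by (metis Ints_cases rational_algebraic_int_is_int)
    have "1 < sqrt (real q)" "sqrt (real q) < 2"
      using that real_sqrt_less_mono[of "real q" 4] by auto
    then show False unfolding m by auto
  qed
  from *[of 2] *[of 3] show "sqrt 2 \<notin> \<rat>" "sqrt 3 \<notin> \<rat>" by simp_all
qed

section \<open>Transfer between pair states\<close>

definition pair_fourier :: "nat \<Rightarrow> real \<Rightarrow> int \<Rightarrow> int \<Rightarrow> int \<Rightarrow> complex" where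
  "pair_fourier n s \<alpha> \<beta> k = chi n (k * \<alpha>) + of_real s * chi n (k * \<beta>)"

text \<open>This is the system for the adjacency matrix; \<open>pst_pair_iff\<close> reduces the
  other Hamiltonians to it.\<close>

definition transfer_phase :: "nat \<Rightarrow> real \<Rightarrow> int \<Rightarrow> int \<Rightarrow> int \<Rightarrow> real \<Rightarrow> complex \<Rightarrow> bool" where
  "transfer_phase n s b \<alpha> \<beta> \<tau> \<eta> \<longleftrightarrow> cmod \<eta> = 1 \<and>
     (\<forall>k. cis (- 2 * \<tau> * cosine n k) * pair_fourier n s 0 b k = \<eta> * pair_fourier n s \<alpha> \<beta> k)"

text \<open>The eigenvalue support of the initial state: only at these frequencies does the equation
  constrain \<open>\<tau>\<close>.\<close>

definition support :: "nat \<Rightarrow> real \<Rightarrow> int \<Rightarrow> int set" where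
  "support n s b = {k. pair_fourier n s 0 b k \<noteq> 0}"

lemma fourier_pair_state:
  assumes "\<alpha> < n" "\<beta> < n"
  shows "fourier n (pair_state s \<alpha> \<beta>) = pair_fourier n s (int \<alpha>) (int \<beta>)"
proof
  fix k
  have "fourier n (pair_state s \<alpha> \<beta>) k = (\<Sum>j<n. if j = \<alpha> then chi n (k * int j) else 0)
     + (\<Sum>j<n. if j = \<beta> then of_real s * chi n (k * int j) else 0)"
    unfolding fourier_def pair_state_def sum.distrib[symmetric]
    by (intro sum.cong refl) (simp add: algebra_simps)
  then show "fourier n (pair_state s \<alpha> \<beta>) k = pair_fourier n s (int \<alpha>) (int \<beta>) k"
    using assms by (simp add: pair_fourier_def)
qed

lemma cnj_pair_fourier: "cnj (pair_fourier n s \<alpha> \<beta> k) = pair_fourier n s \<alpha> \<beta> (- k)"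
  by (simp add: pair_fourier_def cnj_chi)

text \<open>A shift of the spectrum by \<open>a\<close> only turns \<open>\<eta>\<close> by a
  constant. The sign \<open>c = - 1\<close> reverses time; conjugation undoes this, since the
  conjugate of a transform at \<open>k\<close> is its value at \<open>- k\<close>.\<close>

lemma pst_pair_iff:
  assumes n: "n \<ge> 3" and M: "M \<in> {cyc_adj n, cyc_lap n, cyc_slap n}"
    and lt: "b < n" "\<alpha> < n" "\<beta> < n"
  shows "pst n M (pair_state s 0 b) (pair_state s \<alpha> \<beta>) \<tau>
     \<longleftrightarrow> \<tau> > 0 \<and> (\<exists>\<eta>. transfer_phase n s (int b) (int \<alpha>) (int \<beta>) \<tau> \<eta>)"
proof -
  have "\<exists>a c. c \<in> {1, - 1} \<and> M = (\<lambda>i j. (if i = j then of_real a else 0) + of_real c * cyc_adj n i j)"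
  proof -
    have "cyc_adj n = (\<lambda>i j. (if i = j then of_real 0 else 0) + of_real 1 * cyc_adj n i j)"
      "cyc_lap n = (\<lambda>i j. (if i = j then of_real 2 else 0) + of_real (- 1) * cyc_adj n i j)"
      "cyc_slap n = (\<lambda>i j. (if i = j then of_real 2 else 0) + of_real 1 * cyc_adj n i j)"
      by (auto simp: fun_eq_iff cyc_lap_def cyc_slap_def cyc_deg_def)
    with M show ?thesis by blast
  qed
  then obtain a c where c: "c \<in> {1, - 1}"
    and Meq: "M = (\<lambda>i j. (if i = j then of_real a else 0) + of_real c * cyc_adj n i j)"
    by blast
  let ?ev = "eigenvalue n a c"
  let ?u = "pair_fourier n s 0 (int b)" and ?v = "pair_fourier n s (int \<alpha>) (int \<beta>)"
  have "pst n M (pair_state s 0 b) (pair_state s \<alpha> \<beta>) \<tau> \<longleftrightarrow> \<tau> > 0 \<and> (\<exists>\<eta>. cmod \<eta> = 1 \<and>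
     (\<forall>k. cis (- \<tau> * ?ev k) * ?u k = \<eta> * ?v k))"
    using lt n by (simp add: pst_iff_fourier[OF n Meq] fourier_pair_state)
  moreover have "(\<exists>\<eta>. cmod \<eta> = 1 \<and> (\<forall>k. cis (- \<tau> * ?ev k) * ?u k = \<eta> * ?v k))
    \<longleftrightarrow> (\<exists>\<eta>. cmod \<eta> = 1 \<and> (\<forall>k. cis (- 2 * \<tau> * cosine n k) * ?u k = \<eta> * ?v k))"
    (is "(\<exists>\<eta>. _ \<and> ?L \<eta>) \<longleftrightarrow> (\<exists>\<eta>. _ \<and> ?R \<eta>)")
  proof (cases "c = 1")
    case True
    have ev: "?ev k = a + 2 * cosine n k" for k
      unfolding eigenvalue_def by (simp add: True)
    have "?R (cis (\<tau> * a) * \<eta>)" if L: "?L \<eta>" for \<eta>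
    proof
      fix k
      have "cis (- 2 * \<tau> * cosine n k) = cis (\<tau> * a) * cis (- \<tau> * ?ev k)"
        by (simp add: ev cis_mult algebra_simps)
      then show "cis (- 2 * \<tau> * cosine n k) * ?u k = cis (\<tau> * a) * \<eta> * ?v k"
        using L by (simp only: mult.assoc)
    qed
    moreover have "?L (cis (- (\<tau> * a)) * \<eta>)" if R: "?R \<eta>" for \<eta>
    proof
      fix k
      have "cis (- \<tau> * ?ev k) = cis (- (\<tau> * a)) * cis (- 2 * \<tau> * cosine n k)"
        by (simp add: ev cis_mult algebra_simps)
      then show "cis (- \<tau> * ?ev k) * ?u k = cis (- (\<tau> * a)) * \<eta> * ?v k"
        using R by (simp only: mult.assoc)
    qed
    moreover have "cmod (cis x * \<eta>) = cmod \<eta>" for x \<eta>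
      by (simp add: norm_mult)
    ultimately show ?thesis by metis
  next
    case False
    then have ev: "?ev k = a - 2 * cosine n k" for k
      unfolding eigenvalue_def using c by auto
    have "?R (cis (- (\<tau> * a)) * cnj \<eta>)" if L: "?L \<eta>" for \<eta>
    proof
      fix k
      have "cis (- 2 * \<tau> * cosine n k) = cis (- (\<tau> * a)) * cnj (cis (- \<tau> * ?ev (- k)))"
        by (simp add: ev cis_mult cis_cnj algebra_simps)
      then have "cis (- 2 * \<tau> * cosine n k) * ?u k
          = cis (- (\<tau> * a)) * cnj (cis (- \<tau> * ?ev (- k)) * ?u (- k))"
        by (simp add: cnj_pair_fourier)
      also have "\<dots> = cis (- (\<tau> * a)) * cnj (\<eta> * ?v (- k))"
        using L by (simp only:)
      finally show "cis (- 2 * \<tau> * cosine n k) * ?u k = cis (- (\<tau> * a)) * cnj \<eta> * ?v k"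
        by (simp add: cnj_pair_fourier)
    qed
    moreover have "?L (cis (- (\<tau> * a)) * cnj \<eta>)" if R: "?R \<eta>" for \<eta>
    proof
      fix k
      have "cis (- \<tau> * ?ev k) = cis (- (\<tau> * a)) * cnj (cis (- 2 * \<tau> * cosine n (- k)))"
        by (simp add: ev cis_mult cis_cnj algebra_simps)
      then have "cis (- \<tau> * ?ev k) * ?u k
          = cis (- (\<tau> * a)) * cnj (cis (- 2 * \<tau> * cosine n (- k)) * ?u (- k))"
        by (simp add: cnj_pair_fourier)
      also have "\<dots> = cis (- (\<tau> * a)) * cnj (\<eta> * ?v (- k))"
        using R by (simp only:)
      finally show "cis (- \<tau> * ?ev k) * ?u k = cis (- (\<tau> * a)) * cnj \<eta> * ?v k"
        by (simp add: cnj_pair_fourier)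
    qed
    moreover have "cmod (cis x * cnj \<eta>) = cmod \<eta>" for x \<eta>
      by (simp add: norm_mult)
    ultimately show ?thesis by metis
  qed
  ultimately show ?thesis
    by (simp add: transfer_phase_def)
qed

lemma cis_eq_1E:
  assumes "cis x = 1"
  obtains m :: int where "x = 2 * pi * of_int m"
proof -
  from assms have "cos x = 1" by (simp add: complex_eq_iff)
  with that show thesis by (auto simp: cos_one_2pi_int mult_ac)
qed

lemma cis_eq_minus_1E:
  assumes "cis x = - 1"
  obtains m :: int where "x = pi * of_int (2 * m + 1)"
proof -
  have "cis (x - pi) = 1" using assms by (simp flip: cis_divide)
  then obtain m :: int where "x - pi = 2 * pi * of_int m" by (rule cis_eq_1E)
  with that[of m] show thesis by (simp add: algebra_simps)
qed

section \<open>Consequences of a transfer between pair states\<close>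

context
  fixes n :: nat and s :: real and b \<alpha> \<beta> :: int and \<tau> :: real and \<eta> :: complex
  assumes phase: "transfer_phase n s b \<alpha> \<beta> \<tau> \<eta>" and n_pos: "n > 0"
begin

lemma transfer_phase_eq:
  "cis (- 2 * \<tau> * cosine n k) * pair_fourier n s 0 b k = \<eta> * pair_fourier n s \<alpha> \<beta> k"
  and norm_phase: "cmod \<eta> = 1"
  using phase by (simp_all add: transfer_phase_def)

lemma norm_pair_fourier_eq: "cmod (pair_fourier n s 0 b k) = cmod (pair_fourier n s \<alpha> \<beta> k)"
proof -
  have "cmod (cis (- 2 * \<tau> * cosine n k) * pair_fourier n s 0 b k) = cmod (\<eta> * pair_fourier n s \<alpha> \<beta> k)"
    by (simp only: transfer_phase_eq)
  then show ?thesis by (simp only: norm_mult norm_phase norm_cis mult_1)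
qed

lemma pair_fourier_mult_minus:
  "pair_fourier n s a c k * pair_fourier n s a c (- k) = of_real ((cmod (pair_fourier n s a c k))\<^sup>2)"
  by (simp only: complex_norm_square cnj_pair_fourier)

text \<open>The product of the equations at \<open>k\<close> and \<open>- k\<close> contains the
  transforms only through their squared norms, which agree. What remains is
  \<open>cis (- 4 * \<tau> * cosine n k) = \<eta>\<^sup>2\<close>, independent of \<open>k\<close>
  on the support.\<close>

lemma commensurable_support:
  assumes "\<tau> > 0"
  shows "commensurable n (support n s b)"
proof -
  have "cis (- 4 * \<tau> * cosine n k) = \<eta>\<^sup>2" if "k \<in> support n s b" for k
  proof -
    let ?u = "pair_fourier n s 0 b" and ?v = "pair_fourier n s \<alpha> \<beta>"
    have "cis (- 4 * \<tau> * cosine n k) = cis (- 2 * \<tau> * cosine n k) * cis (- 2 * \<tau> * cosine n (- k))"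
      by (simp add: cis_mult mult.assoc)
    then have "cis (- 4 * \<tau> * cosine n k) * (?u k * ?u (- k))
        = (cis (- 2 * \<tau> * cosine n k) * ?u k) * (cis (- 2 * \<tau> * cosine n (- k)) * ?u (- k))"
      by (simp only: mult_ac)
    also have "\<dots> = \<eta>\<^sup>2 * (?v k * ?v (- k))"
      unfolding transfer_phase_eq by (simp only: power2_eq_square mult_ac)
    finally show ?thesis
      using that by (simp add: pair_fourier_mult_minus support_def flip: norm_pair_fourier_eq)
  qed
  note * = this
  show ?thesis
    unfolding commensurable_def
  \<comment> \<open>Equal phases mean that \<open>4 * \<tau>\<close> times the difference is an
    integer multiple of \<open>2 * pi\<close>; the scale makes that integer visible.\<close>
  proof (intro exI[of _ "2 * \<tau> / pi"] conjI ballI)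
    fix k j assume kj: "k \<in> support n s b" "j \<in> support n s b"
    have "cis (- 4 * \<tau> * cosine n j - - 4 * \<tau> * cosine n k) = 1"
      unfolding cis_divide[symmetric] *[OF kj(1)] *[OF kj(2)] using norm_phase by auto
    then obtain m :: int where "- 4 * \<tau> * cosine n j - - 4 * \<tau> * cosine n k = 2 * pi * of_int m"
      by (rule cis_eq_1E)
    then have "2 * \<tau> / pi * (cosine n k - cosine n j) = of_int m"
      by (simp add: field_simps)
    then show "2 * \<tau> / pi * (cosine n k - cosine n j) \<in> \<rat>" by simp
  qed (use assms in simp)
qed

text \<open>Equal norms at frequency 1 give equal cosines of the two offsets. The alternatives are a
  rotation and a reflection of the cycle.\<close>

lemma transfer_offset:
  assumes "s \<noteq> 0"
  shows "int n dvd \<beta> - \<alpha> - b \<or> int n dvd \<beta> - \<alpha> + b"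
proof -
  have norm: "(cmod (pair_fourier n s a c 1))\<^sup>2 = 1 + s\<^sup>2 + 2 * s * cosine n (c - a)" for a c
  proof -
    have "pair_fourier n s a c 1 * pair_fourier n s a c (- 1)
       = 1 + of_real (s\<^sup>2) + of_real s * (chi n (c - a) + chi n (- (c - a)))"
      by (simp add: pair_fourier_def algebra_simps power2_eq_square flip: chi_add)
    then have "of_real ((cmod (pair_fourier n s a c 1))\<^sup>2)
       = (of_real (1 + s\<^sup>2 + 2 * s * cosine n (c - a)) :: complex)"
      unfolding pair_fourier_mult_minus chi_eq_cosine by simp
    then show ?thesis by (simp only: of_real_eq_iff)
  qed
  have "1 + s\<^sup>2 + 2 * s * cosine n b = 1 + s\<^sup>2 + 2 * s * cosine n (\<beta> - \<alpha>)"
    using norm[of 0 b] norm[of \<alpha> \<beta>] norm_pair_fourier_eq[of 1] by (simp only: diff_0_right)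
  then have "cosine n (\<beta> - \<alpha>) = cosine n b" using assms by auto
  then show ?thesis by (simp add: cosine_eq_iff[OF n_pos])
qed

text \<open>Since the square of \<open>s\<close> is 1, exchanging the endpoints multiplies the
  target by \<open>s\<close>, a factor that \<open>\<eta>\<close> absorbs.\<close>

lemma transfer_swap:
  assumes "s = 1 \<or> s = - 1"
  shows "transfer_phase n s b \<beta> \<alpha> \<tau> (of_real s * \<eta>)"
proof -
  have "\<eta> * pair_fourier n s \<alpha> \<beta> k = of_real s * \<eta> * pair_fourier n s \<beta> \<alpha> k" for k
    using assms by (auto simp: pair_fourier_def algebra_simps)
  then show ?thesis
    using phase assms by (auto simp: transfer_phase_def norm_mult)
qed

text \<open>A rotation by \<open>\<alpha>\<close> multiplies the transform by a character, and the
  nonzero transform of the initial state cancels.\<close>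

lemma shift_phase:
  assumes "int n dvd \<beta> - \<alpha> - b" "k \<in> support n s b"
  shows "cis (- 2 * \<tau> * cosine n k) = \<eta> * chi n (k * \<alpha>)"
proof -
  have "int n dvd k * \<beta> - k * (\<alpha> + b)"
    using assms(1) dvd_mult[of "int n" "\<beta> - \<alpha> - b" k] by (simp add: algebra_simps)
  then have "chi n (k * \<beta>) = chi n (k * (\<alpha> + b))"
    by (rule chi_cong[OF n_pos])
  then have "pair_fourier n s \<alpha> \<beta> k = chi n (k * \<alpha>) * pair_fourier n s 0 b k"
    by (simp add: pair_fourier_def algebra_simps chi_add)
  with transfer_phase_eq[of k] assms(2) show ?thesis
    by (simp add: support_def)
qed

lemma support_minus: "k \<in> support n s b \<Longrightarrow> - k \<in> support n s b"
  unfolding support_def using cnj_pair_fourier[of n s 0 b k] by auto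

text \<open>The cosine is even in \<open>k\<close> while the rotation character is inverted by
  \<open>k \<mapsto> - k\<close>; equality at both forces its square to be 1.\<close>

lemma shift_dvd:
  assumes "int n dvd \<beta> - \<alpha> - b" "k \<in> support n s b"
  shows "int n dvd 2 * \<alpha> * k"
proof -
  have "\<eta> * chi n (k * \<alpha>) = \<eta> * chi n (- k * \<alpha>)"
    using shift_phase[OF assms] shift_phase[OF assms(1) support_minus[OF assms(2)]] by simp
  then have "chi n (k * \<alpha>) = chi n (- k * \<alpha>)" using norm_phase by auto
  then have "chi n (k * \<alpha>) * chi n (k * \<alpha>) = chi n (k * \<alpha>) * chi n (- (k * \<alpha>))"
    by (simp only: mult_minus_left)
  then have "chi n (k * \<alpha>) * chi n (k * \<alpha>) = 1" by (simp only: chi_minus_mult)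
  then show ?thesis
    by (simp add: chi_eq_1_iff[OF n_pos] algebra_simps flip: chi_add)
qed

lemma shift_phase_diff:
  assumes "int n dvd \<beta> - \<alpha> - b" "k \<in> support n s b" "j \<in> support n s b"
  shows "cis (2 * \<tau> * (cosine n k - cosine n j)) = chi n (\<alpha> * (j - k))"
proof -
  have "cis (2 * \<tau> * (cosine n k - cosine n j))
      = cis (- 2 * \<tau> * cosine n j) / cis (- 2 * \<tau> * cosine n k)"
    by (simp add: cis_divide algebra_simps)
  also have "\<dots> = chi n (\<alpha> * j) / chi n (\<alpha> * k)"
    unfolding shift_phase[OF assms(1,2)] shift_phase[OF assms(1,3)]
    using norm_phase by (auto simp: mult.commute)
  also have "chi n (\<alpha> * j) = chi n (\<alpha> * (j - k)) * chi n (\<alpha> * k)"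
    by (simp add: algebra_simps flip: chi_add)
  finally show ?thesis by simp
qed

text \<open>The half turn has character (-1)^k, so phase differences are even or odd multiples of
  \<open>pi\<close> according to \<open>k - j\<close>. These parities give the minimum times and
  refute the impossible cases.\<close>

lemma half_shift_parity:
  assumes "int n dvd \<beta> - \<alpha> - b" "2 * \<alpha> = int n" "k \<in> support n s b" "j \<in> support n s b"
  obtains p :: int where "2 * \<tau> * (cosine n k - cosine n j) = pi * of_int p" "even p \<longleftrightarrow> even (k - j)"
proof (cases "even (k - j)")
  case True
  then obtain l where "k - j = 2 * l" ..
  then have "\<alpha> * (j - k) = int n * - l" using assms(2) by (simp add: algebra_simps)
  then have "cis (2 * \<tau> * (cosine n k - cosine n j)) = 1"
    using shift_phase_diff[OF assms(1,3,4)] n_pos by (simp add: chi_eq_1_iff)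
  then obtain m :: int where "2 * \<tau> * (cosine n k - cosine n j) = 2 * pi * of_int m"
    by (rule cis_eq_1E)
  with True show thesis by (intro that[of "2 * m"]) auto
next
  case False
  then obtain l where "k - j = 2 * l + 1" by (elim oddE)
  then have "\<alpha> * (j - k) = int n * (- l - 1) + \<alpha>" using assms(2) by (simp add: algebra_simps)
  moreover have "chi n \<alpha> = - 1"
  proof -
    have "2 * pi * of_int \<alpha> = pi * of_int (2 * \<alpha>)" by simp
    then have "2 * pi * of_int \<alpha> / real n = pi"
      unfolding assms(2) using n_pos by (simp only: of_int_of_nat_eq) simp
    then show ?thesis by (simp only: chi_def cis_pi)
  qed
  ultimately have "cis (2 * \<tau> * (cosine n k - cosine n j)) = - 1"
    using shift_phase_diff[OF assms(1,3,4)] n_pos chi_eq_1_iff[OF n_pos, of "int n * (- l - 1)"]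
    by (simp add: chi_add)
  then obtain m :: int where "2 * \<tau> * (cosine n k - cosine n j) = pi * of_int (2 * m + 1)"
    by (rule cis_eq_minus_1E)
  with False show thesis by (intro that[of "2 * m + 1"]) auto
qed

end

section \<open>The listed transfers\<close>

lemma chi_mod_self: "n > 0 \<Longrightarrow> chi n (k mod int n) = chi n k"
  by (rule chi_cong) (simp_all flip: mod_eq_dvd_iff)

lemma cosine_mod_self: "n > 0 \<Longrightarrow> cosine n (k mod int n) = cosine n k"
  by (simp add: cosine_eq_Re chi_mod_self)

lemma pair_fourier_mod_self: "n > 0 \<Longrightarrow> pair_fourier n s \<alpha> \<beta> (k mod int n) = pair_fourier n s \<alpha> \<beta> k"
  by (simp add: pair_fourier_def chi_mod)

lemma transfer_phaseI:
  assumes "n > 0" "cmod \<eta> = 1"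
    and "\<And>k. k \<in> {0..<int n} \<Longrightarrow>
      cis (- 2 * \<tau> * cosine n k) * pair_fourier n s 0 b k = \<eta> * pair_fourier n s \<alpha> \<beta> k"
  shows "transfer_phase n s b \<alpha> \<beta> \<tau> \<eta>"
  unfolding transfer_phase_def
proof (intro conjI allI)
  fix k
  show "cis (- 2 * \<tau> * cosine n k) * pair_fourier n s 0 b k = \<eta> * pair_fourier n s \<alpha> \<beta> k"
    using assms(3)[of "k mod int n"] assms(1) by (simp add: cosine_mod_self pair_fourier_mod_self)
qed (fact assms)

section \<open>Tables of roots of unity and cosines\<close>

lemma chi_4:
  "chi 4 k = (if k mod 4 = 0 then 1 else if k mod 4 = 1 then \<i> else if k mod 4 = 2 then - 1 else - \<i>)"
proof -
  have 1: "chi 4 1 = \<i>"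
    by (simp add: chi_def complex_eq_iff)
  have 2: "chi 4 2 = - 1" using chi_add[of 4 1 1] by (simp add: 1)
  have 3: "chi 4 3 = - \<i>" using chi_add[of 4 2 1] by (simp add: 1 2)
  have "k mod 4 \<in> {0, 1, 2, 3}" by auto
  then show ?thesis
    using chi_mod_self[of 4 k] 1 2 3 by auto
qed

lemma chi_6:
  "chi 6 k = (if k mod 6 = 0 then 1 else if k mod 6 = 1 then Complex (1 / 2) (sqrt 3 / 2)
     else if k mod 6 = 2 then Complex (- 1 / 2) (sqrt 3 / 2) else if k mod 6 = 3 then - 1
     else if k mod 6 = 4 then Complex (- 1 / 2) (- sqrt 3 / 2) else Complex (1 / 2) (- sqrt 3 / 2))"
proof -
  have 1: "chi 6 1 = Complex (1 / 2) (sqrt 3 / 2)"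
    by (simp add: chi_def complex_eq_iff cos_60 sin_60)
  have 2: "chi 6 2 = Complex (- 1 / 2) (sqrt 3 / 2)"
    using chi_add[of 6 1 1] by (simp add: 1 complex_eq_iff)
  have 3: "chi 6 3 = - 1"
    using chi_add[of 6 2 1] by (simp add: 1 2 complex_eq_iff)
  have 4: "chi 6 4 = Complex (- 1 / 2) (- sqrt 3 / 2)"
    using chi_add[of 6 3 1] by (simp add: 1 3 complex_eq_iff)
  have 5: "chi 6 5 = Complex (1 / 2) (- sqrt 3 / 2)"
    using chi_add[of 6 3 2] by (simp add: 2 3 complex_eq_iff)
  have "k mod 6 \<in> {0, 1, 2, 3, 4, 5}" by auto
  then show ?thesis
    using chi_mod_self[of 6 k] 1 2 3 4 5 by auto
qed

lemma chi_8:
  "chi 8 k = (if k mod 8 = 0 then 1 else if k mod 8 = 1 then Complex (sqrt 2 / 2) (sqrt 2 / 2)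
     else if k mod 8 = 2 then \<i> else if k mod 8 = 3 then Complex (- sqrt 2 / 2) (sqrt 2 / 2)
     else if k mod 8 = 4 then - 1 else if k mod 8 = 5 then Complex (- sqrt 2 / 2) (- sqrt 2 / 2)
     else if k mod 8 = 6 then - \<i> else Complex (sqrt 2 / 2) (- sqrt 2 / 2))"
proof -
  have 1: "chi 8 1 = Complex (sqrt 2 / 2) (sqrt 2 / 2)"
    by (simp add: chi_def complex_eq_iff cos_45 sin_45)
  have 2: "chi 8 2 = \<i>"
    using chi_add[of 8 1 1] by (simp add: 1 complex_eq_iff)
  have 3: "chi 8 3 = Complex (- sqrt 2 / 2) (sqrt 2 / 2)"
    using chi_add[of 8 2 1] by (simp add: 1 2 complex_eq_iff)
  have 4: "chi 8 4 = - 1"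
    using chi_add[of 8 2 2] by (simp add: 2)
  have 5: "chi 8 5 = Complex (- sqrt 2 / 2) (- sqrt 2 / 2)"
    using chi_add[of 8 4 1] by (simp add: 1 4 complex_eq_iff)
  have 6: "chi 8 6 = - \<i>"
    using chi_add[of 8 4 2] by (simp add: 2 4)
  have 7: "chi 8 7 = Complex (sqrt 2 / 2) (- sqrt 2 / 2)"
    using chi_add[of 8 4 3] by (simp add: 3 4 complex_eq_iff)
  have "k mod 8 \<in> {0, 1, 2, 3, 4, 5, 6, 7}" by auto
  then show ?thesis
    using chi_mod_self[of 8 k] 1 2 3 4 5 6 7 by auto
qed

lemma cosine_12_values:
  "cosine 12 1 = sqrt 3 / 2" "cosine 12 2 = 1 / 2" "cosine 12 3 = 0" "cosine 12 4 = - 1 / 2"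
proof -
  show "cosine 12 1 = sqrt 3 / 2" by (simp add: cosine_def cos_30)
  show "cosine 12 2 = 1 / 2" by (simp add: cosine_def cos_60)
  show "cosine 12 3 = 0" by (simp add: cosine_def)
  show "cosine 12 4 = - 1 / 2"
    using cosine_double[of 12 2] \<open>cosine 12 2 = 1 / 2\<close> by (simp add: power2_eq_square)
qed

lemma cis_values: "cis (- pi) = - 1" "cis (- (pi / 2)) = - \<i>" "cis (- (2 * pi)) = 1"
  by (simp_all add: complex_eq_iff)

section \<open>Verification of the listed transfers frequency by frequency\<close>

lemma transfer_4_1: "transfer_phase 4 s 1 2 3 (pi / 2) (- 1)"
proof (rule transfer_phaseI)
  fix k :: int assume "k \<in> {0..<int 4}"
  then have "k \<in> {0, 1, 2, 3}" by auto
  then show "cis (- 2 * (pi / 2) * cosine 4 k) * pair_fourier 4 s 0 1 k = - 1 * pair_fourier 4 s 2 3 k"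
    by (elim insertE emptyE) (simp_all add: pair_fourier_def cosine_eq_Re chi_4 cis_values)
qed auto

lemma transfer_4_2: "transfer_phase 4 s 2 2 0 (pi / 2) (- 1)"
proof (rule transfer_phaseI)
  fix k :: int assume "k \<in> {0..<int 4}"
  then have "k \<in> {0, 1, 2, 3}" by auto
  then show "cis (- 2 * (pi / 2) * cosine 4 k) * pair_fourier 4 s 0 2 k = - 1 * pair_fourier 4 s 2 0 k"
    by (elim insertE emptyE) (simp_all add: pair_fourier_def cosine_eq_Re chi_4 cis_values)
qed auto

lemma transfer_4_2_plus: "transfer_phase 4 1 2 1 3 (pi / 4) (- \<i>)"
proof (rule transfer_phaseI)
  fix k :: int assume "k \<in> {0..<int 4}"
  then have "k \<in> {0, 1, 2, 3}" by auto
  then show "cis (- 2 * (pi / 4) * cosine 4 k) * pair_fourier 4 1 0 2 k = - \<i> * pair_fourier 4 1 1 3 k"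
    by (elim insertE emptyE) (simp_all add: pair_fourier_def cosine_eq_Re chi_4 cis_values)
qed auto

lemma transfer_6_minus: "transfer_phase 6 (- 1) 2 3 5 (pi / 2) \<i>"
proof (rule transfer_phaseI)
  fix k :: int assume "k \<in> {0..<int 6}"
  then have "k \<in> {0, 1, 2, 3, 4, 5}" by auto
  then show "cis (- 2 * (pi / 2) * cosine 6 k) * pair_fourier 6 (- 1) 0 2 k = \<i> * pair_fourier 6 (- 1) 3 5 k"
    by (elim insertE emptyE) (simp_all add: pair_fourier_def cosine_eq_Re chi_6 cis_values complex_eq_iff)
qed auto

lemma transfer_6_2: "transfer_phase 6 2 2 0 4 pi 1"
proof (rule transfer_phaseI)
  fix k :: int assume "k \<in> {0..<int 6}"
  then have "k \<in> {0, 1, 2, 3, 4, 5}" by auto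
  then show "cis (- 2 * pi * cosine 6 k) * pair_fourier 6 2 0 2 k = 1 * pair_fourier 6 2 0 4 k"
    by (elim insertE emptyE) (simp_all add: pair_fourier_def cosine_eq_Re chi_6 cis_values complex_eq_iff)
qed auto

lemma transfer_6_half: "transfer_phase 6 (1 / 2) 2 4 2 pi 1"
proof (rule transfer_phaseI)
  fix k :: int assume "k \<in> {0..<int 6}"
  then have "k \<in> {0, 1, 2, 3, 4, 5}" by auto
  then show "cis (- 2 * pi * cosine 6 k) * pair_fourier 6 (1 / 2) 0 2 k = 1 * pair_fourier 6 (1 / 2) 4 2 k"
    by (elim insertE emptyE) (simp_all add: pair_fourier_def cosine_eq_Re chi_6 cis_values complex_eq_iff)
qed auto

lemma transfer_8_minus: "transfer_phase 8 (- 1) 2 4 6 (pi / sqrt 2) 1"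
proof (rule transfer_phaseI)
  fix k :: int assume "k \<in> {0..<int 8}"
  then have "k \<in> {0, 1, 2, 3, 4, 5, 6, 7}" by auto
  then show "cis (- 2 * (pi / sqrt 2) * cosine 8 k) * pair_fourier 8 (- 1) 0 2 k
      = 1 * pair_fourier 8 (- 1) 4 6 k"
    by (elim insertE emptyE) (simp_all add: pair_fourier_def cosine_eq_Re chi_8 cis_values complex_eq_iff)
qed auto

lemma transfer_8_plus: "transfer_phase 8 1 4 2 6 (pi / 2) (- 1)"
proof (rule transfer_phaseI)
  fix k :: int assume "k \<in> {0..<int 8}"
  then have "k \<in> {0, 1, 2, 3, 4, 5, 6, 7}" by auto
  then show "cis (- 2 * (pi / 2) * cosine 8 k) * pair_fourier 8 1 0 4 k = - 1 * pair_fourier 8 1 2 6 k"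
    by (elim insertE emptyE) (simp_all add: pair_fourier_def cosine_eq_Re chi_8 cis_values complex_eq_iff)
qed auto

lemma pair_pst_if_listed_case:
  assumes n: "n \<ge> 4" and s: "s \<noteq> 0"
    and M: "M \<in> {cyc_adj n, cyc_lap n, cyc_slap n}" and listed: "listed_case n b s w \<tau>"
  shows "pair_pst n M s b w \<tau>"
proof -
  have *: "pair_pst n M s b w \<tau>"
    if "b < n" "\<alpha> < n" "\<beta> < n" "\<alpha> \<noteq> \<beta>" "w = pair_state s \<alpha> \<beta>" "\<tau> > 0"
      "transfer_phase n s (int b) (int \<alpha>) (int \<beta>) \<tau> \<eta>"
      "\<And>c. \<exists>i<n. pair_state s \<alpha> \<beta> i \<noteq> c * pair_state s 0 b i" for \<alpha> \<beta> \<eta>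
  proof -
    have "pst n M (pair_state s 0 b) w \<tau>"
      using pst_pair_iff[OF _ M, of b \<alpha> \<beta> s \<tau>] n that by auto
    moreover have "is_s_pair_state n s w"
      using that by (auto simp: is_s_pair_state_def)
    moreover have "\<not> scalar_multiple n w (pair_state s 0 b)"
      unfolding scalar_multiple_def \<open>w = _\<close> using that(8) by blast
    ultimately show ?thesis by (simp add: pair_pst_def)
  qed
  note [simp] = pair_state_def and [simp del] = eq_divide_eq_numeral1
  consider "n = 4 \<and> b = 1 \<and> w = pair_state s 2 3 \<and> \<tau> = pi / 2"
   | "n = 4 \<and> b = 2 \<and> s \<notin> {-1, 0, 1} \<and> w = pair_state s 2 0 \<and> \<tau> = pi / 2"
   | "n = 4 \<and> b = 2 \<and> s = 1 \<and> w = pair_state s 1 3 \<and> \<tau> = pi / 4"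
   | "n = 6 \<and> b = 2 \<and> s = -1 \<and> w = pair_state s 3 5 \<and> \<tau> = pi / 2"
   | "n = 6 \<and> b = 2 \<and> s = 2 \<and> w = pair_state s 0 4 \<and> \<tau> = pi"
   | "n = 6 \<and> b = 2 \<and> s = 1 / 2 \<and> w = pair_state s 4 2 \<and> \<tau> = pi"
   | "n = 8 \<and> b = 2 \<and> s = -1 \<and> w = pair_state s 4 6 \<and> \<tau> = pi / sqrt 2"
   | "n = 8 \<and> b = 4 \<and> s = 1 \<and> w = pair_state s 2 6 \<and> \<tau> = pi / 2"
    using listed unfolding listed_case_def by argo
  then show ?thesis
  proof cases
    case 1
    \<comment> \<open>Outside case 2 the coordinate supplied is one where the target is nonzero and
      the initial state vanishes.\<close>
    then show ?thesis
      by (intro *[of 2 3 "- 1"]) (auto simp: transfer_4_1 intro!: exI[of _ 2])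
  next
    case 2
    \<comment> \<open>Coordinate 0 forces \<open>c = s\<close>, and coordinate 2 would then force
      the square of \<open>s\<close> to be 1.\<close>
    have "\<exists>i<n. pair_state s 2 0 i \<noteq> c * pair_state s 0 b i" for c
    proof (cases "c = of_real s")
      case True
      have "complex_of_real s * of_real s \<noteq> 1"
        using 2 by (auto simp: square_eq_1_iff simp flip: of_real_mult)
      then show ?thesis using 2 True by (intro exI[of _ 2]) auto
    qed (use 2 in \<open>auto intro!: exI[of _ 0]\<close>)
    with 2 show ?thesis
      by (intro *[of 2 0 "- 1"]) (auto simp: transfer_4_2 simp del: pair_state_def)
  next
    case 3
    then show ?thesis
      by (intro *[of 1 3 "- \<i>"]) (auto simp: transfer_4_2_plus intro!: exI[of _ 1])
  next
    case 4
    then show ?thesis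
      by (intro *[of 3 5 "\<i>"]) (auto simp: transfer_6_minus intro!: exI[of _ 3])
  next
    case 5
    then show ?thesis
      by (intro *[of 0 4 1]) (auto simp: transfer_6_2 intro!: exI[of _ 4])
  next
    case 6
    then show ?thesis
      by (intro *[of 4 2 1]) (auto simp: transfer_6_half intro!: exI[of _ 4])
  next
    case 7
    then show ?thesis
      by (intro *[of 4 6 1]) (auto simp: transfer_8_minus intro!: exI[of _ 4])
  next
    case 8
    then show ?thesis
      by (intro *[of 2 6 "- 1"]) (auto simp: transfer_8_plus intro!: exI[of _ 2])
  qed
qed

section \<open>Transfer by a rotation\<close>

definition sine :: "nat \<Rightarrow> int \<Rightarrow> real" where
  "sine n k = Im (chi n k)"

text \<open>Eliminating \<open>\<tau>\<close> and \<open>\<eta>\<close> from the equations at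
  \<open>k\<close> and \<open>- k\<close> shows that \<open>?u (- k) * ?v k\<close> equals its
  conjugate. Its imaginary part is a quadratic in \<open>s\<close>, which later decides the
  reflections.\<close>

lemma transfer_sine_eq:
  assumes "transfer_phase n s b \<alpha> \<beta> \<tau> \<eta>" "n > 0"
  shows "sine n (k * \<alpha>) + s * sine n (k * \<beta>) + s * sine n (k * (\<alpha> - b)) + s\<^sup>2 * sine n (k * (\<beta> - b)) = 0"
proof -
  let ?u = "pair_fourier n s 0 b" and ?v = "pair_fourier n s \<alpha> \<beta>"
  let ?z = "cis (- 2 * \<tau> * cosine n k)"
  note eq = transfer_phase_eq[OF assms]
  have "\<eta> \<noteq> 0" using norm_phase[OF assms] by auto
  have "?z * ?u (- k) = \<eta> * ?v (- k)" using eq[of "- k"] by simp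
  then have "?z * (?u (- k) * ?v k) = \<eta> * ?v (- k) * ?v k" by (simp only: mult.assoc[symmetric])
  also have "\<dots> = ?z * (?u k * ?v (- k))" using eq[of k] by (simp add: mult_ac)
  finally have "?u (- k) * ?v k = ?u k * ?v (- k)" by simp
  then have "?u (- k) * ?v k = cnj (?u (- k) * ?v k)"
    by (simp add: cnj_pair_fourier)
  then have "Im (?u (- k) * ?v k) = - Im (?u (- k) * ?v k)"
    by (metis cnj.sel(2))
  then have "Im (?u (- k) * ?v k) = 0" by linarith
  moreover have "?u (- k) * ?v k = chi n (k * \<alpha>) + of_real s * chi n (k * \<beta>)
      + of_real s * chi n (k * (\<alpha> - b)) + of_real (s\<^sup>2) * chi n (k * (\<beta> - b))"
    by (simp add: pair_fourier_def algebra_simps power2_eq_square flip: chi_add)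
  ultimately show ?thesis by (simp add: sine_def)
qed

lemma scalar_multiple_refl: "scalar_multiple n v v"
  unfolding scalar_multiple_def by (rule exI[of _ 1]) simp

lemma scalar_multiple_trans:
  "scalar_multiple n u v \<Longrightarrow> scalar_multiple n v w \<Longrightarrow> scalar_multiple n u w"
  unfolding scalar_multiple_def by (metis mult.assoc)

lemma scalar_multiple_swap:
  assumes "s = 1 \<or> s = - 1"
  shows "scalar_multiple n (pair_state s \<alpha> \<beta>) (pair_state s \<beta> \<alpha>)"
  unfolding scalar_multiple_def
  by (rule exI[of _ "of_real s"]) (use assms in \<open>auto simp: pair_state_def\<close>)

section \<open>Frequencies at which the initial state does not vanish\<close>

lemma support_all:
  assumes "s \<noteq> 1" "s \<noteq> - 1"
  shows "k \<in> support n s b"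
proof -
  have "cmod (of_real s * chi n (k * b)) \<noteq> 1"
    using assms by (simp add: norm_mult)
  then have "1 + of_real s * chi n (k * b) \<noteq> 0"
    by (metis add_eq_0_iff norm_minus_cancel norm_one)
  then show ?thesis by (simp add: support_def pair_fourier_def)
qed

lemma support_minus_1:
  assumes "n > 0" "\<not> int n dvd k * b"
  shows "k \<in> support n (- 1) b"
  using assms by (simp add: support_def pair_fourier_def chi_eq_1_iff)

text \<open>The transform vanishes only where the character is -1, so that its square is 1 but it is
  not; the implication excludes this.\<close>

lemma support_plus_1:
  assumes "n > 0" "int n dvd 2 * k * b \<Longrightarrow> int n dvd k * b"
  shows "k \<in> support n 1 b"
proof -
  have "chi n (k * b) \<noteq> - 1"
  proof
    assume eq: "chi n (k * b) = - 1"
    then have "chi n (k * b + k * b) = 1" unfolding chi_add by simp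
    moreover have "k * b + k * b = 2 * k * b" by simp
    ultimately have "int n dvd 2 * k * b"
      using assms(1) by (simp only: chi_eq_1_iff)
    then have "chi n (k * b) = 1" using assms by (simp add: chi_eq_1_iff)
    with eq show False by simp
  qed
  then show ?thesis
    by (simp add: support_def pair_fourier_def add_eq_0_iff)
qed

text \<open>Turns the parity of a phase into a lower bound for the transfer time.\<close>

lemma odd_multiple_le:
  assumes "x = pi * of_int p" "odd p" "x > 0"
  shows "pi \<le> x"
proof -
  have "p > 0" using assms by (simp add: zero_less_mult_iff)
  then have "pi * 1 \<le> pi * of_int p" by (intro mult_left_mono) auto
  then show ?thesis using assms by simp
qed

text \<open>Refutes phase conditions that would make a multiple of \<open>sqrt 2\<close> or
  \<open>sqrt 3\<close> rational.\<close>

lemma ratio_rational: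
  assumes "x = pi * of_int p" "q * x = pi * of_int m" "x \<noteq> 0"
  shows "q \<in> \<rat>"
proof -
  have "q = (q * x) / x" using assms(3) by simp
  also have "\<dots> = of_int m / of_int p" unfolding assms(2) unfolding assms(1) by simp
  also have "\<dots> \<in> \<rat>" by simp
  finally show ?thesis .
qed

lemma dvd_offset:
  fixes n b \<alpha> \<beta> :: nat
  assumes "int n dvd int \<beta> - int \<alpha> - int b" "\<alpha> < n" "\<beta> < n" "b < n"
  shows "\<beta> = \<alpha> + b \<or> \<beta> + n = \<alpha> + b"
proof -
  have n_pos: "int n > 0" using assms(2) by simp
  obtain m where m: "int \<beta> - int \<alpha> - int b = int n * m" using assms(1) ..
  \<comment> \<open>The multiple of \<open>n\<close> lies strictly between \<open>- 2 * n\<close>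
    and \<open>n\<close>, which leaves 0 and \<open>- n\<close>.\<close>
  have "int n * m < int n * 1" "int n * (- 2) < int n * m"
    unfolding m[symmetric] using assms(2-4) by auto
  then have "m < 1" "- 2 < m" using n_pos by (simp_all only: mult_less_cancel_left_pos)
  then have "m = 0 \<or> m = - 1" by auto
  with m show ?thesis by auto
qed

section \<open>Case analysis for rotated targets\<close>

context
  fixes n b \<alpha> \<beta> :: nat and s \<tau> :: real and \<eta> :: complex
  assumes n: "n \<ge> 4" and b: "1 \<le> b" "2 * b \<le> n" and s: "s \<noteq> 0"
    and lt: "\<alpha> < n" "\<beta> < n" and \<tau>: "\<tau> > 0"
    and phase: "transfer_phase n s (int b) (int \<alpha>) (int \<beta>) \<tau> \<eta>"
    and shift: "int n dvd int \<beta> - int \<alpha> - int b"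
    and non_trivial: "\<not> scalar_multiple n (pair_state s \<alpha> \<beta>) (pair_state s 0 b)"
begin

lemma n_pos: "n > 0" using n by simp

lemma b_less: "b < n" using n b by simp

lemma target_offset: "\<beta> = \<alpha> + b \<or> \<beta> + n = \<alpha> + b"
  by (rule dvd_offset[OF shift lt b_less])

lemma shift_nonzero: "\<alpha> \<noteq> 0"
proof
  assume "\<alpha> = 0"
  then have "\<beta> = b" using target_offset lt b_less by auto
  with \<open>\<alpha> = 0\<close> show False using non_trivial scalar_multiple_refl by simp
qed

lemma not_swapped: "s = 1 \<or> s = - 1 \<Longrightarrow> \<not> (\<alpha> = b \<and> \<beta> = 0)"
  using non_trivial scalar_multiple_swap[of s n b 0] by metis

lemma commensurable_if_supported: "T \<subseteq> support n s (int b) \<Longrightarrow> commensurable n T"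
  using commensurable_support[OF phase n_pos \<tau>] by (rule commensurable_subset)

lemma half_shift: "1 \<in> support n s (int b) \<Longrightarrow> 2 * \<alpha> = n"
proof -
  assume "1 \<in> support n s (int b)"
  then have "int n dvd 2 * int \<alpha>"
    using shift_dvd[OF phase n_pos shift] by force
  then have "n dvd 2 * \<alpha>" by presburger
  then obtain m where m: "2 * \<alpha> = n * m" ..
  have "n * m < n * 2" using m lt by linarith
  then have "m < 2" by simp
  moreover have "m \<noteq> 0" using m shift_nonzero by (intro notI) simp
  ultimately have "m = 1" by simp
  with m show ?thesis by simp
qed

lemma parity:
  assumes "1 \<in> support n s (int b)" "k \<in> support n s (int b)" "j \<in> support n s (int b)"
  obtains p :: int where "2 * \<tau> * (cosine n k - cosine n j) = pi * of_int p" "even p \<longleftrightarrow> even (k - j)"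
proof -
  have "2 * int \<alpha> = int n" using half_shift[OF assms(1)] by simp
  from half_shift_parity[OF phase n_pos shift this assms(2,3)] that show thesis by blast
qed

text \<open>The target is matched only up to a scalar because for \<open>s = 1\<close> or
  \<open>s = - 1\<close> its endpoints may appear exchanged.\<close>

abbreviation listed_outcome :: bool where
  "listed_outcome \<equiv> \<exists>w \<tau>0. listed_case n b s w \<tau>0 \<and> scalar_multiple n (pair_state s \<alpha> \<beta>) w \<and> \<tau>0 \<le> \<tau>"

lemma listed_outcomeI:
  "listed_case n b s w \<tau>0 \<Longrightarrow> scalar_multiple n (pair_state s \<alpha> \<beta>) w \<Longrightarrow> \<tau>0 \<le> \<tau> \<Longrightarrow> listed_outcome"
  by blast

text \<open>The half turn exchanges the endpoints, which for \<open>s = - 1\<close> only changes the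
  sign of the state.\<close>

lemma case_antipodal_minus:
  assumes "2 * b = n" "s = - 1"
  shows False
proof -
  have "\<not> int n dvd 1 * int b"
    using b b_less by (intro not_int_dvd) auto
  then have "1 \<in> support n s (int b)"
    unfolding assms(2) by (rule support_minus_1[OF n_pos])
  then have "2 * \<alpha> = n" by (rule half_shift)
  then show False using assms target_offset lt not_swapped by auto
qed

text \<open>The character at \<open>b\<close> is (-1)^k, so odd frequencies vanish and a half turn
  is not forced: frequency 2 only gives \<open>n dvd 4 * \<alpha>\<close>. Commensurability leaves
  the lengths 4, 6, 8 and 12.\<close>

lemma case_antipodal_plus:
  assumes "2 * b = n" "s = 1"
  shows listed_outcome
proof -
  have even: "2 * k \<in> support n s (int b)" for k
    unfolding assms(2) by (rule support_plus_1[OF n_pos]) (simp add: assms(1)[symmetric])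
  have "{- 2, 0, 2, 4} \<subseteq> support n s (int b)"
    using even[of "- 1"] even[of 0] even[of 1] even[of 2] by simp
  then have "b \<in> {2, 3, 4, 6}"
    using commensurable_even[of b] commensurable_if_supported assms(1) n by simp
  have "int n dvd 2 * int \<alpha> * 2"
    using shift_dvd[OF phase n_pos shift even[of 1]] by simp
  then have dvd: "n dvd 4 * \<alpha>" by presburger
  have "\<alpha> \<noteq> b"
    using assms target_offset lt not_swapped by auto
  note diff = shift_phase_diff[OF phase n_pos shift even even]
  consider "b = 2" | "b = 3" | "b = 4" | "b = 6"
    using \<open>b \<in> {2, 3, 4, 6}\<close> by blast
  then show ?thesis
  proof cases
    case 1
    then have n4: "n = 4" using assms by simp
    then have "(\<alpha> = 1 \<and> \<beta> = 3) \<or> (\<alpha> = 3 \<and> \<beta> = 1)"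
      using 1 target_offset lt shift_nonzero \<open>\<alpha> \<noteq> b\<close> by auto
    then have "scalar_multiple n (pair_state s \<alpha> \<beta>) (pair_state s 1 3)"
      using scalar_multiple_refl scalar_multiple_swap[of s n 3 1] assms(2) by auto
    \<comment> \<open>Frequencies 0 and 2 are compared; on four vertices their cosines differ by
      2.\<close>
    moreover have "cis (4 * \<tau>) = - 1"
      using diff[of 0 1] \<open>_ \<or> _\<close> unfolding n4 by (auto simp: chi_4 cosine_eq_Re)
    then obtain m :: int where "4 * \<tau> = pi * of_int (2 * m + 1)"
      by (rule cis_eq_minus_1E)
    then have "pi \<le> 4 * \<tau>" using \<tau> by (intro odd_multiple_le[of _ "2 * m + 1"]) auto
    ultimately show ?thesis
      using 1 n4 assms(2) by (intro listed_outcomeI[of "pair_state s 1 3" "pi / 4"]) (auto simp: listed_case_def)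
  next
    case 2
    then have "n = 6" using assms by simp
    then have "3 dvd \<alpha>" using dvd by presburger
    \<comment> \<open>The multiples of 3 below 6 are 0, which is trivial, and \<open>b\<close>,
      which exchanges the endpoints.\<close>
    then show ?thesis using \<open>n = 6\<close> 2 lt \<open>\<alpha> \<noteq> b\<close> shift_nonzero by presburger
  next
    case 3
    then have n8: "n = 8" using assms by simp
    then have "2 dvd \<alpha>" using dvd by presburger
    then have "(\<alpha> = 2 \<and> \<beta> = 6) \<or> (\<alpha> = 6 \<and> \<beta> = 2)"
      using n8 3 target_offset lt shift_nonzero \<open>\<alpha> \<noteq> b\<close> by presburger
    then have "scalar_multiple n (pair_state s \<alpha> \<beta>) (pair_state s 2 6)"
      using scalar_multiple_refl scalar_multiple_swap[of s n 6 2] assms(2) by auto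
    moreover have "cis (2 * \<tau>) = - 1"
      using diff[of 0 1] \<open>_ \<or> _\<close> unfolding n8 by (auto simp: chi_8 cosine_eq_Re)
    then obtain m :: int where "2 * \<tau> = pi * of_int (2 * m + 1)"
      by (rule cis_eq_minus_1E)
    then have "pi \<le> 2 * \<tau>" using \<tau> by (intro odd_multiple_le[of _ "2 * m + 1"]) auto
    ultimately show ?thesis
      using 3 n8 assms(2) by (intro listed_outcomeI[of "pair_state s 2 6" "pi / 2"]) (auto simp: listed_case_def)
  next
    case 4
    then have n12: "n = 12" using assms by simp
    then have "3 dvd \<alpha>" using dvd by presburger
    then have "\<alpha> = 3 \<or> \<alpha> = 9"
      using n12 4 lt shift_nonzero \<open>\<alpha> \<noteq> b\<close> by presburger
    then have "(chi n (int \<alpha> * 2))\<^sup>2 = 1" "chi n (int \<alpha> * 2) \<noteq> 1" "chi n (int \<alpha> * 4) = 1"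
      by (auto simp: n12 chi_power chi_eq_1_iff)
    then have \<alpha>: "chi n (int \<alpha> * 2) = - 1" "chi n (int \<alpha> * 4) = 1"
      by (auto simp: power2_eq_1_iff)
    \<comment> \<open>From frequency 0 to 2 and to 4 the cosine drops by 1/2 and by 3/2, so the
      second phase is the cube of the first, yet the cube of -1 is not 1.\<close>
    have "cis \<tau> = - 1" "cis (3 * \<tau>) = 1"
      using diff[of 0 1] diff[of 0 2] \<alpha> by (simp_all add: n12 cosine_12_values mult_ac)
    moreover have "cis (3 * \<tau>) = cis \<tau> * cis \<tau> * cis \<tau>"
      by (simp add: cis_mult algebra_simps)
    ultimately have False by simp
    then show ?thesis ..
  qed
qed

text \<open>The character at \<open>b\<close> is the k-th power of the imaginary unit, so odd
  frequencies survive for both signs. In addition 0 survives for \<open>s = 1\<close> and 2 for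
  \<open>s = - 1\<close>.\<close>

lemma case_quarter:
  assumes "4 * b = n" "s = 1 \<or> s = - 1"
  shows listed_outcome
proof -
  have odd: "k \<in> support n s (int b)" if "odd k" for k
  proof -
    have "\<not> 4 dvd k" "\<not> 4 dvd 2 * k" using that by presburger+
    then have "\<not> int n dvd k * int b" "\<not> int n dvd 2 * k * int b"
      using assms(1)[symmetric] b by simp_all
    then show ?thesis
      using assms(2) support_minus_1[OF n_pos] support_plus_1[OF n_pos] by auto
  qed
  then have "b \<in> {1, 2, 3}"
    using commensurable_odd[of b] commensurable_if_supported[of "{1, 3, 5, 7}"] assms(1) b by simp
  have zero: "0 \<in> support n s (int b)" if "s = 1"
    unfolding that by (rule support_plus_1[OF n_pos]) simp
  have two: "2 \<in> support n s (int b)" if "s = - 1"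
    unfolding that by (rule support_minus_1[OF n_pos]) (use assms(1)[symmetric] b in simp)
  have one: "1 \<in> support n s (int b)" by (rule odd) simp
  have "2 * \<alpha> = n" by (rule half_shift[OF one])
  then have \<alpha>\<beta>: "\<alpha> = 2 * b" "\<beta> = 3 * b"
    using assms(1) target_offset b lt by auto
  note parity = parity[OF one]
  consider "b = 1" | "b = 2" | "b = 3"
    using \<open>b \<in> {1, 2, 3}\<close> by blast
  then show ?thesis
  proof cases
    case 1
    then have n4: "n = 4" using assms by simp
    have "\<exists>p. odd p \<and> 2 * \<tau> = pi * of_int p"
      using assms(2)
    proof
      assume "s = 1"
      from parity[OF zero[OF this] one] show ?thesis
        by (auto simp: n4 chi_4 cosine_eq_Re)
    next
      assume "s = - 1"
      from parity[OF one two[OF this]] show ?thesis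
        by (auto simp: n4 chi_4 cosine_eq_Re)
    qed
    then have "pi \<le> 2 * \<tau>" using \<tau> odd_multiple_le by force
    then show ?thesis
      using 1 n4 \<alpha>\<beta> scalar_multiple_refl
      by (intro listed_outcomeI[of "pair_state s 2 3" "pi / 2"]) (auto simp: listed_case_def)
  next
    case 2
    then have n8: "n = 8" using assms by simp
    from assms(2) show ?thesis
    proof
      assume [simp]: "s = 1"
      have four: "4 \<in> support n s (int b)"
        unfolding \<open>s = 1\<close> by (rule support_plus_1[OF n_pos]) (simp add: n8 2)
      \<comment> \<open>The differences c_0 - c_4 = 2 and c_1 - c_3 = \<open>sqrt 2\<close> have an
        irrational ratio.\<close>
      obtain p where p: "4 * \<tau> = pi * of_int p"
        using parity[OF zero four] by (auto simp: n8 chi_8 cosine_eq_Re)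
      obtain q where q: "2 * \<tau> * sqrt 2 = pi * of_int q"
        using parity[OF one odd[of 3]] by (auto simp: n8 chi_8 cosine_eq_Re)
      have "sqrt 2 / 2 * (4 * \<tau>) = pi * of_int q" using q by (simp add: mult_ac)
      from ratio_rational[OF p this] have "sqrt 2 / 2 \<in> \<rat>" using \<tau> by simp
      then have "2 * (sqrt 2 / 2) \<in> \<rat>" by (intro Rats_mult) auto
      then show ?thesis using sqrt_2_irrational by simp
    next
      assume s: "s = - 1"
      \<comment> \<open>The listed time comes from c_1 - c_2 = \<open>sqrt 2 / 2\<close>.\<close>
      obtain p where p: "sqrt 2 * \<tau> = pi * of_int p" "odd p"
        using parity[OF one two[OF s]] by (auto simp: n8 chi_8 cosine_eq_Re mult_ac)
      have "0 < sqrt 2 * \<tau>" using \<tau> by simp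
      from odd_multiple_le[OF p this] have "pi \<le> sqrt 2 * \<tau>" .
      then have "pi / sqrt 2 \<le> \<tau>" by (simp add: divide_le_eq mult.commute)
      then show ?thesis
        using 2 n8 s \<alpha>\<beta> scalar_multiple_refl
        by (intro listed_outcomeI[of "pair_state s 4 6" "pi / sqrt 2"]) (auto simp: listed_case_def)
    qed
  next
    case 3
    then have n12: "n = 12" using assms by simp
    have three: "3 \<in> support n s (int b)" by (rule odd) simp
    \<comment> \<open>c_1 - c_3 = \<open>sqrt 3 / 2\<close> is played against a rational difference,
      c_0 - c_3 or c_2 - c_3 according to the sign.\<close>
    obtain q where q: "\<tau> * sqrt 3 = pi * of_int q"
      using parity[OF one three] by (auto simp: n12 cosine_12_values)
    from assms(2) have "sqrt 3 \<in> \<rat>"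
    proof
      assume s: "s = 1"
      obtain p where p: "2 * \<tau> = pi * of_int p"
        using parity[OF zero[OF s] three] by (auto simp: n12 cosine_12_values)
      have "sqrt 3 / 2 * (2 * \<tau>) = pi * of_int q" using q by (simp add: mult_ac)
      from ratio_rational[OF p this] have "sqrt 3 / 2 \<in> \<rat>" using \<tau> by simp
      then have "2 * (sqrt 3 / 2) \<in> \<rat>" by (intro Rats_mult) auto
      then show ?thesis by simp
    next
      assume s: "s = - 1"
      obtain p where p: "\<tau> = pi * of_int p"
        using parity[OF two[OF s] three] by (auto simp: n12 cosine_12_values)
      show ?thesis
        using p q \<tau> by (intro ratio_rational[of \<tau> p _ q]) (auto simp: mult.commute)
    qed
    then show ?thesis using sqrt_3_irrational by simp
  qed
qed

text \<open>The transform vanishes exactly at the multiples of 3, so the argument through powers of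
  2 takes the place of consecutive frequencies.\<close>

lemma case_third_minus:
  assumes "3 * b = n" "s = - 1"
  shows listed_outcome
proof -
  have supp: "k \<in> support n s (int b)" if "\<not> 3 dvd k" for k
    unfolding assms(2)
    by (rule support_minus_1[OF n_pos]) (use assms(1)[symmetric] b that in simp)
  have "b = 2"
    using commensurable_coprime_3[of b] commensurable_if_supported[of "{1, 2, 4, 8}"] supp assms(1) n by simp
  then have n6: "n = 6" using assms by simp
  have one: "1 \<in> support n s (int b)" and two: "2 \<in> support n s (int b)"
    by (rule supp; simp)+
  have "2 * \<alpha> = n" by (rule half_shift[OF one])
  then have "\<alpha> = 3" "\<beta> = 5" using n6 \<open>b = 2\<close> target_offset by auto
  obtain p where p: "2 * \<tau> = pi * of_int p" "odd p"
    using parity[OF one one two] by (auto simp: n6 chi_6 cosine_eq_Re)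
  then have "pi \<le> 2 * \<tau>" using \<tau> by (intro odd_multiple_le[of _ p]) auto
  then show ?thesis
    using n6 \<open>b = 2\<close> \<open>\<alpha> = 3\<close> \<open>\<beta> = 5\<close> assms(2) scalar_multiple_refl
    by (intro listed_outcomeI[of "pair_state s 3 5" "pi / 2"]) (auto simp: listed_case_def)
qed

text \<open>On six vertices c_1 - c_2 = 1 makes \<open>2 * \<tau>\<close> an odd multiple of
  \<open>pi\<close>, while c_0 - c_1 or c_2 - c_3, both 1/2, makes it an even one. Hence
  \<open>n = 4\<close>.\<close>

lemma case_rational:
  assumes "n \<in> {4, 6}" "b = 2 \<and> n = 4 \<longrightarrow> s \<noteq> 1 \<and> s \<noteq> - 1"
    and one: "1 \<in> support n s (int b)" and two: "2 \<in> support n s (int b)"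
    and "0 \<in> support n s (int b) \<or> 3 \<in> support n s (int b)"
  shows listed_outcome
proof -
  note parity = parity[OF one]
  have \<alpha>: "2 * \<alpha> = n" by (rule half_shift[OF one])
  have "n = 4"
  proof (rule ccontr)
    assume "n \<noteq> 4"
    then have n6: "n = 6" using assms by simp
    obtain p where p: "2 * \<tau> = pi * of_int p" "odd p"
      using parity[OF one two] by (auto simp: n6 chi_6 cosine_eq_Re)
    obtain q where q: "\<tau> = pi * of_int q"
      using assms(5)
    proof
      assume "0 \<in> support n s (int b)"
      from parity[OF this one] that show thesis
        by (auto simp: n6 chi_6 cosine_eq_Re)
    next
      assume "3 \<in> support n s (int b)"
      from parity[OF two this] that show thesis
        by (auto simp: n6 chi_6 cosine_eq_Re)
    qed
    have "pi * of_int p = pi * of_int (2 * q)" using p q by simp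
    then have "p = 2 * q" by (simp only: mult_cancel_left of_int_eq_iff pi_neq_zero) simp
    then show False using p by simp
  qed
  obtain p where p: "2 * \<tau> = pi * of_int p" "odd p"
    using parity[OF one two] by (auto simp: \<open>n = 4\<close> chi_4 cosine_eq_Re)
  then have \<tau>_ge: "pi \<le> 2 * \<tau>" using \<tau> by (intro odd_multiple_le[of _ p]) auto
  have "b = 1 \<or> b = 2" using b \<open>n = 4\<close> by auto
  then show ?thesis
  proof
    assume "b = 1"
    then show ?thesis
      using \<open>n = 4\<close> \<alpha> target_offset \<tau>_ge scalar_multiple_refl
      by (intro listed_outcomeI[of "pair_state s 2 3" "pi / 2"]) (auto simp: listed_case_def)
  next
    assume "b = 2"
    then have "\<alpha> = 2" "\<beta> = 0" using \<open>n = 4\<close> \<alpha> target_offset lt by auto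
    then show ?thesis
      using \<open>n = 4\<close> \<open>b = 2\<close> assms(2) s \<tau>_ge scalar_multiple_refl
      by (intro listed_outcomeI[of "pair_state s 2 0" "pi / 2"]) (auto simp: listed_case_def)
  qed
qed

text \<open>For each \<open>s\<close> the exceptional \<open>b\<close> are those for which a
  frequency used for commensurability leaves the support. Otherwise \<open>n\<close> is 4 or 6 and
  \<open>case_rational\<close> finishes.\<close>

lemma shift_necessity: listed_outcome
proof -
  \<comment> \<open>The multiples of \<open>b\<close> up to \<open>4 * b\<close> do not exceed
    \<open>2 * n\<close>, so divisibility by \<open>n\<close> becomes one of two equations.\<close>
  have dvd_le: "x = n \<or> x = 2 * n" if "int n dvd int x" "0 < x" "x \<le> 2 * n" for x
  proof -
    have "n dvd x" using that(1) by simp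
    then obtain m where m: "x = n * m" ..
    then have "n * m \<le> n * 2" using that(3) by simp
    then have "m \<le> 2" using n_pos by simp
    moreover have "m \<noteq> 0" using m that(2) by auto
    ultimately have "m = 1 \<or> m = 2" by auto
    with m show ?thesis by auto
  qed
  consider "s \<noteq> 1" "s \<noteq> - 1" | "s = 1" | "s = - 1" by blast
  then show ?thesis
  proof cases
    case 1
    note supp = support_all[OF 1]
    have "n \<in> {4, 6}"
      by (rule commensurable_around_0[OF commensurable_if_supported n]) (use supp in auto)
    then show ?thesis using case_rational supp 1 by blast
  next
    case 2
    consider "2 * b = n" | "4 * b = n" | "2 * b \<noteq> n" "4 * b \<noteq> n" by blast
    then show ?thesis
    proof cases
      case 3
      have zero: "0 \<in> support n s (int b)"
        unfolding 2 by (rule support_plus_1[OF n_pos]) simp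
      have one: "1 \<in> support n s (int b)"
        unfolding 2 by (rule support_plus_1[OF n_pos]) (use dvd_le[of "2 * b"] 3 b n in auto)
      have two: "2 \<in> support n s (int b)"
        unfolding 2 by (rule support_plus_1[OF n_pos]) (use dvd_le[of "4 * b"] 3 b n in auto)
      have minus: "- 1 \<in> support n s (int b)"
        using support_minus[OF phase n_pos one] by simp
      have n46: "n \<in> {4, 6}"
        by (rule commensurable_around_0[OF commensurable_if_supported n]) (use zero one two minus in auto)
      show ?thesis
        by (rule case_rational[OF n46 _ one two]) (use 3 zero in auto)
    qed (use 2 case_antipodal_plus case_quarter in blast)+
  next
    case minus: 3
    consider "2 * b = n" | "3 * b = n" | "4 * b = n" | "2 * b \<noteq> n" "3 * b \<noteq> n" "4 * b \<noteq> n"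
      by blast
    then show ?thesis
    proof cases
      case 4
      have one: "1 \<in> support n s (int b)"
        unfolding minus by (rule support_minus_1[OF n_pos]) (use dvd_le[of b] 4 b n in auto)
      have two: "2 \<in> support n s (int b)"
        unfolding minus by (rule support_minus_1[OF n_pos]) (use dvd_le[of "2 * b"] 4 b n in auto)
      have three: "3 \<in> support n s (int b)"
        unfolding minus by (rule support_minus_1[OF n_pos]) (use dvd_le[of "3 * b"] 4 b n in auto)
      have four: "4 \<in> support n s (int b)"
        unfolding minus by (rule support_minus_1[OF n_pos]) (use dvd_le[of "4 * b"] 4 b n in auto)
      \<comment> \<open>Frequency 1 forces a half turn, which needs even \<open>n\<close>; this
        removes the exception of \<open>commensurable_1_to_4\<close>.\<close>
      have "n \<noteq> 5" using half_shift[OF one] by presburger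
      then have n46: "n \<in> {4, 6}"
        by (intro commensurable_1_to_4[OF commensurable_if_supported n]) (use one two three four in auto)
      show ?thesis
        by (rule case_rational[OF n46 _ one two]) (use 4 three in auto)
    qed (use minus case_antipodal_minus case_third_minus case_quarter in blast)+
  qed
qed

end

section \<open>Transfer by a reflection\<close>

text \<open>The quotient of the two phases gives \<open>cis \<tau> = - 1\<close>.\<close>

lemma ge_pi_if_cis_eq:
  assumes "cis (- 2 * \<tau>) = \<eta>" "cis (- \<tau>) = - \<eta>" "\<tau> > 0"
  shows "pi \<le> \<tau>"
proof -
  have "cis \<tau> = cis (2 * \<tau>) * cis (- \<tau>)" by (simp add: cis_mult)
  also have "\<dots> = cis (2 * \<tau>) * - cis (- 2 * \<tau>)" by (simp only: assms(1,2))
  also have "\<dots> = - 1" by (simp add: cis_mult)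
  finally obtain m :: int where "\<tau> = pi * of_int (2 * m + 1)" by (rule cis_eq_minus_1E)
  then show ?thesis using assms(3) by (intro odd_multiple_le[of _ "2 * m + 1"]) auto
qed

text \<open>The first phase is the square of the second, so \<open>\<eta> = 1\<close>; then two
  mutually inverse numbers would be 1 and -1.\<close>

lemma cis_eq_contradiction:
  assumes "cis (- 2 * \<tau>) = \<eta>" "cis (- \<tau>) = \<eta>" "cis (2 * \<tau>) = - \<eta>"
  shows False
proof -
  have "cis (- \<tau>) * cis (- \<tau>) = cis (- 2 * \<tau>)" by (simp add: cis_mult)
  then have "\<eta> * \<eta> = \<eta>" using assms by simp
  then have "\<eta> = 1" using assms(1) by auto
  moreover have "cis (2 * \<tau>) * cis (- 2 * \<tau>) = 1" by (simp add: cis_mult)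
  ultimately show False using assms by simp
qed

text \<open>Every frequency is in the support, so \<open>n\<close> is 4 or 6. The quadratic from
  \<open>transfer_sine_eq\<close> leaves few values of \<open>s\<close>, and the phases at
  frequencies 0, 1 and 3 decide which of them occur.\<close>

lemma reflection_necessity:
  fixes n b \<alpha> \<beta> :: nat and s \<tau> :: real
  assumes n: "n \<ge> 4" and b: "1 \<le> b" "2 * b < n" and s: "s \<noteq> 0" "s \<noteq> 1" "s \<noteq> - 1"
    and lt: "\<alpha> < n" "\<beta> < n" and \<tau>: "\<tau> > 0"
    and phase: "transfer_phase n s (int b) (int \<alpha>) (int \<beta>) \<tau> \<eta>"
    and reflection: "int n dvd int \<beta> - int \<alpha> + int b"
  shows "(n = 6 \<and> b = 2 \<and> s = 2 \<and> \<alpha> = 0 \<and> \<beta> = 4 \<or> n = 6 \<and> b = 2 \<and> s = 1 / 2 \<and> \<alpha> = 4 \<and> \<beta> = 2) \<and> pi \<le> \<tau>"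
proof -
  have n_pos: "n > 0" using n by simp
  have "commensurable n {- 1, 0, 1, 2}"
    using commensurable_support[OF phase n_pos \<tau>] support_all[OF s(2,3)]
    by (rule_tac commensurable_subset) auto
  then have "n \<in> {4, 6}" using commensurable_around_0 n by blast
  have "int n dvd - (int \<beta> - int \<alpha> + int b)" using reflection by (simp only: dvd_minus_iff)
  then have "int n dvd int \<alpha> - int \<beta> - int b" by (simp add: algebra_simps)
  then have offset: "\<alpha> = \<beta> + b \<or> \<alpha> + n = \<beta> + b"
    using lt b by (intro dvd_offset) auto
  note sines = transfer_sine_eq[OF phase n_pos]
  note eq = transfer_phase_eq[OF phase n_pos]
  have s2: "s\<^sup>2 \<noteq> 1" using s by (simp add: power2_eq_1_iff)
  have "n = 6"
  proof (rule ccontr)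
    assume "n \<noteq> 6"
    then have n4: "n = 4" using \<open>n \<in> {4, 6}\<close> by simp
    then have "b = 1" using b by simp
    have "(\<alpha> = 0 \<and> \<beta> = 3) \<or> (\<alpha> = 1 \<and> \<beta> = 0) \<or> (\<alpha> = 2 \<and> \<beta> = 1) \<or> (\<alpha> = 3 \<and> \<beta> = 2)"
      using lt offset unfolding n4 \<open>b = 1\<close> by presburger
    then show False
      using sines[of 1] s s2 unfolding n4 \<open>b = 1\<close> sine_def
      by (elim disjE conjE) (simp_all add: chi_4)
  qed
  \<comment> \<open>\<open>t\<close> is the sign pattern of the sine on six vertices; dividing by
    its size \<open>r\<close> leaves equations in \<open>s\<close> with integer
    coefficients.\<close>
  define t :: "int \<Rightarrow> real" where
    "t k = (if k mod 6 \<in> {1, 2} then 1 else if k mod 6 \<in> {4, 5} then - 1 else 0)" for k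
  define r where "r = sqrt 3 / 2"
  have r: "r \<noteq> 0" by (simp add: r_def)
  have sine_6: "sine 6 k = r * t k" for k
  proof -
    have "k mod 6 \<in> {0, 1, 2, 3, 4, 5}" by auto
    then show ?thesis
      unfolding sine_def chi_6 t_def r_def by (elim insertE emptyE) simp_all
  qed
  have eq6: "t (k * \<alpha>) + s * t (k * \<beta>) + s * t (k * (int \<alpha> - b)) + s\<^sup>2 * t (k * (int \<beta> - b)) = 0"
    (is "?S = 0") for k :: int
  proof -
    have "r * ?S = 0"
      using sines[of k] unfolding \<open>n = 6\<close> sine_6 by (simp add: algebra_simps)
    with r show ?thesis by simp
  qed
  have "b = 1 \<or> b = 2" using b \<open>n = 6\<close> by auto
  then have "b = 2"
  proof
    assume "b = 1"
    have "(\<alpha> = 0 \<and> \<beta> = 5) \<or> (\<alpha> = 1 \<and> \<beta> = 0) \<or> (\<alpha> = 2 \<and> \<beta> = 1) \<or> (\<alpha> = 3 \<and> \<beta> = 2)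
        \<or> (\<alpha> = 4 \<and> \<beta> = 3) \<or> (\<alpha> = 5 \<and> \<beta> = 4)"
      using lt offset unfolding \<open>n = 6\<close> \<open>b = 1\<close> by presburger
    then have False
      using eq6[of 1] eq6[of 2] s s2 unfolding \<open>b = 1\<close>
      by (elim disjE conjE; simp add: t_def; linarith)
    then show ?thesis ..
  qed
  have "(\<alpha> = 0 \<and> \<beta> = 4) \<or> (\<alpha> = 1 \<and> \<beta> = 5) \<or> (\<alpha> = 2 \<and> \<beta> = 0) \<or> (\<alpha> = 3 \<and> \<beta> = 1)
        \<or> (\<alpha> = 4 \<and> \<beta> = 2) \<or> (\<alpha> = 5 \<and> \<beta> = 3)"
    using lt offset unfolding \<open>n = 6\<close> \<open>b = 2\<close> by presburger
  \<comment> \<open>Two of the six reflections require the square of \<open>s\<close> to be 1; the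
    others give 2 or 1/2.\<close>
  then have cases: "(\<alpha> = 0 \<and> \<beta> = 4 \<and> s = 2) \<or> (\<alpha> = 1 \<and> \<beta> = 5 \<and> s = 1 / 2)
      \<or> (\<alpha> = 3 \<and> \<beta> = 1 \<and> s = 2) \<or> (\<alpha> = 4 \<and> \<beta> = 2 \<and> s = 1 / 2)"
    using eq6[of 1] s s2 unfolding \<open>b = 2\<close>
    by (elim disjE conjE) (simp_all add: t_def power2_eq_square field_simps)
  have s1: "1 + complex_of_real s \<noteq> 0"
    using s by (metis add_eq_0_iff of_real_1 of_real_eq_iff of_real_minus)
  then have e0: "cis (- 2 * \<tau>) = \<eta>"
    using eq[of 0] by (simp add: pair_fourier_def)
  define w where "w = pair_fourier n s 0 (int b) 1"
  have "w \<noteq> 0"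
    using support_all[OF s(2,3), of 1 n "int b"] by (simp add: support_def w_def)
  have e1: "cis (- \<tau>) * w = \<eta> * pair_fourier n s \<alpha> \<beta> 1"
    using eq[of 1] by (simp add: w_def \<open>n = 6\<close> chi_6 cosine_eq_Re)
  have e3: "cis (2 * \<tau>) * pair_fourier n s 0 (int b) 3 = \<eta> * pair_fourier n s \<alpha> \<beta> 3"
    using eq[of 3] by (simp add: \<open>n = 6\<close> chi_6 cosine_eq_Re)
  \<comment> \<open>For odd \<open>\<alpha>\<close> the transform is unchanged at frequency 1 but
    changes sign at frequency 3.\<close>
  have odd: False if "\<alpha> = 3 \<and> \<beta> = 1 \<and> s = 2 \<or> \<alpha> = 1 \<and> \<beta> = 5 \<and> s = 1 / 2"
  proof (rule cis_eq_contradiction[OF e0])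
    have "pair_fourier n s \<alpha> \<beta> 1 = w"
      using that by (elim disjE conjE)
        (simp_all add: w_def pair_fourier_def \<open>n = 6\<close> \<open>b = 2\<close> chi_6 complex_eq_iff)
    then show "cis (- \<tau>) = \<eta>" using e1 \<open>w \<noteq> 0\<close> by simp
    have "pair_fourier n s 0 (int b) 3 = 1 + of_real s"
      by (simp add: pair_fourier_def \<open>n = 6\<close> \<open>b = 2\<close> chi_6)
    moreover have "pair_fourier n s \<alpha> \<beta> 3 = - (1 + of_real s)"
      using that by (elim disjE conjE) (simp_all add: pair_fourier_def \<open>n = 6\<close> chi_6)
    ultimately have "cis (2 * \<tau>) * (1 + of_real s) = - \<eta> * (1 + of_real s)"
      using e3 by (simp only: mult_minus_left mult_minus_right)
    then show "cis (2 * \<tau>) = - \<eta>" using s1 by (simp only: mult_cancel_right) simp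
  qed
  \<comment> \<open>For even \<open>\<alpha>\<close> the sign changes at frequency 1, which fixes
    the minimum time.\<close>
  have even: "pi \<le> \<tau>" if "\<alpha> = 0 \<and> \<beta> = 4 \<and> s = 2 \<or> \<alpha> = 4 \<and> \<beta> = 2 \<and> s = 1 / 2"
  proof (rule ge_pi_if_cis_eq[OF e0 _ \<tau>])
    have "pair_fourier n s \<alpha> \<beta> 1 = - w"
      using that by (elim disjE conjE)
        (simp_all add: w_def pair_fourier_def \<open>n = 6\<close> \<open>b = 2\<close> chi_6 complex_eq_iff)
    then have "cis (- \<tau>) * w = - \<eta> * w" using e1 by simp
    then show "cis (- \<tau>) = - \<eta>" using \<open>w \<noteq> 0\<close> by (simp only: mult_cancel_right) simp
  qed
  show ?thesis
    using cases odd even \<open>n = 6\<close> \<open>b = 2\<close> by blast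
qed

section \<open>From an arbitrary transfer to the list\<close>

lemma listed_case_if_pair_pst:
  assumes n: "n \<ge> 4" and b: "1 \<le> b" "2 * b \<le> n" and s: "s \<noteq> 0"
    and M: "M \<in> {cyc_adj n, cyc_lap n, cyc_slap n}" and pst: "pair_pst n M s b v \<tau>"
  shows "\<exists>w \<tau>0. listed_case n b s w \<tau>0 \<and> scalar_multiple n v w \<and> \<tau>0 \<le> \<tau>"
proof -
  obtain \<alpha> \<beta> where v: "v = pair_state s \<alpha> \<beta>" and lt: "\<alpha> < n" "\<beta> < n"
    using pst by (auto simp: pair_pst_def is_s_pair_state_def)
  have non_trivial: "\<not> scalar_multiple n (pair_state s \<alpha> \<beta>) (pair_state s 0 b)"
    using pst by (simp add: pair_pst_def v)
  have n_pos: "n > 0" using n by simp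
  have "pst n M (pair_state s 0 b) (pair_state s \<alpha> \<beta>) \<tau>"
    using pst by (simp add: pair_pst_def v)
  moreover have "n \<ge> 3" "b < n" using n b by simp_all
  ultimately obtain \<eta> where \<tau>: "\<tau> > 0" and phase: "transfer_phase n s (int b) (int \<alpha>) (int \<beta>) \<tau> \<eta>"
    using pst_pair_iff[OF _ M] lt by blast
  consider "int n dvd int \<beta> - int \<alpha> - int b"
    | "int n dvd int \<beta> - int \<alpha> + int b" "s = 1 \<or> s = - 1"
    | "int n dvd int \<beta> - int \<alpha> + int b" "s \<noteq> 1" "s \<noteq> - 1" "\<not> int n dvd int \<beta> - int \<alpha> - int b"
    using transfer_offset[OF phase n_pos s] by blast
  then show ?thesis
  proof cases
    case 1
    then show ?thesis
      unfolding v by (rule shift_necessity[OF n b s lt \<tau> phase _ non_trivial])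
  next
    case 2
    \<comment> \<open>Exchanging the endpoints of the target turns this reflection into a
      rotation.\<close>
    have "int n dvd - (int \<beta> - int \<alpha> + int b)" using 2(1) by (simp only: dvd_minus_iff)
    then have "int n dvd int \<alpha> - int \<beta> - int b" by (simp add: algebra_simps)
    moreover have "\<not> scalar_multiple n (pair_state s \<beta> \<alpha>) (pair_state s 0 b)"
      using non_trivial scalar_multiple_swap[OF 2(2)] scalar_multiple_trans by blast
    ultimately have "\<exists>w \<tau>0. listed_case n b s w \<tau>0 \<and> scalar_multiple n (pair_state s \<beta> \<alpha>) w \<and> \<tau>0 \<le> \<tau>"
      by (rule shift_necessity[OF n b s lt(2,1) \<tau> transfer_swap[OF phase n_pos 2(2)]])
    then show ?thesis
      unfolding v using scalar_multiple_swap[OF 2(2)] scalar_multiple_trans by blast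
  next
    case 3
    \<comment> \<open>For antipodal pairs a reflection is also a rotation, which belongs to the
      first case.\<close>
    have "2 * b \<noteq> n"
    proof
      assume "2 * b = n"
      then have "int \<beta> - int \<alpha> - int b = (int \<beta> - int \<alpha> + int b) - int n" by auto
      then show False using 3(1,4) by (metis dvd_diff dvd_refl)
    qed
    then have "2 * b < n" using b by simp
    from reflection_necessity[OF n b(1) this s 3(2,3) lt \<tau> phase 3(1)]
    have *: "n = 6 \<and> b = 2 \<and> s = 2 \<and> \<alpha> = 0 \<and> \<beta> = 4 \<or> n = 6 \<and> b = 2 \<and> s = 1 / 2 \<and> \<alpha> = 4 \<and> \<beta> = 2"
      "pi \<le> \<tau>"
      by auto
    then have "listed_case n b s v pi" by (auto simp: listed_case_def v)
    with *(2) scalar_multiple_refl show ?thesis by blast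
  qed
qed

text \<open>Necessity yields some listed target, while the theorem speaks of every listed one; they
  agree because the cases are disjoint in \<open>n\<close>, \<open>b\<close> and
  \<open>s\<close>.\<close>

lemma listed_case_unique:
  assumes "listed_case n b s w \<tau>" "listed_case n b s w' \<tau>'"
  shows "w = w' \<and> \<tau> = \<tau>'"
  using assms unfolding listed_case_def by (elim disjE conjE) simp_all

theorem mainTheorem9:
  fixes n b :: nat and s :: real and M :: "nat \<Rightarrow> nat \<Rightarrow> complex"
  assumes "n \<ge> 4" and "1 \<le> b" and "2 * b \<le> n" and "s \<noteq> 0"
    and "M \<in> {cyc_adj n, cyc_lap n, cyc_slap n}"
  shows "((\<exists>v \<tau>. pair_pst n M s b v \<tau>) \<longleftrightarrow> (\<exists>w \<tau>0. listed_case n b s w \<tau>0))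
    \<and> (\<forall>w \<tau>0. listed_case n b s w \<tau>0 \<longrightarrow>
         pair_pst n M s b w \<tau>0 \<and>
         (\<forall>v \<tau>. pair_pst n M s b v \<tau> \<longrightarrow> scalar_multiple n v w \<and> \<tau>0 \<le> \<tau>))"
  using pair_pst_if_listed_case[OF assms(1,4,5)] listed_case_if_pair_pst[OF assms] listed_case_unique by blast

end
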